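(* For two one-counter nets $\mathcal N$ and $\mathcal N'$ with sets of control states $Q$ and $Q'$, one can in polynomial time construct a one-counter net $\mathcal M$ with control states $M\supseteq Q$ and an $\omega$-net $\mathcal M'$ with control states $M'\supseteq Q'$ such that for each pair $(q,q')\in Q\times Q'$ and all $n,n'\in\mathbb N$: $qn\sqsubseteq q'n'$ with respect to $\mathcal N,\mathcal N'$ if and only if $qn\preceq q'n'$ with respect to $\mathcal M,\mathcal M'$.
   Context: OCN $(Q,\mathrm{Act},\delta)$ with $\delta\subseteq Q\times\mathrm{Act}\times\{-1,0,1\}\times Q$ induces the LTS on $Q\times\mathbb N$ with $pm\xrightarrow{a}qn$ iff $(p,a,d,q)\in\delta$, $n=m+d\ge0$. An $\omega$-net $(Q,\mathrm{Act},\delta)$ has $\delta\subseteq Q\times\mathrm{Act}\times\{-1,0,1,\omega\}\times Q$ and induces the LTS on $Q\times\mathbb N$ with $pm\xrightarrow{a}qn$ iff either $(p,a,d,q)\in\delta$ with $d\in\{-1,0,1\}$ and $n=m+d\ge 0$, or $(p,a,\omega,q)\in\delta$ and $n>m$. Relations between two systems are on the disjoint union of their LTSs. $\preceq$ is strong simulation preorder: the largest relation $R$ such that for $(c,c')\in R$ and $c\xrightarrow{a}d$ there is $c'\xrightarrow{a}d'$ with $(d,d')\in R$. $\sqsubseteq$ is weak simulation preorder: the largest relation $R$ such that for $(c,c')\in R$ and $c\xrightarrow{a}d$ there is $c'\overset{a}{\Longrightarrow}d'$ with $(d,d')\in R$, where for the silent action $\tau\in\mathrm{Act}$, $\overset{\tau}{\Longrightarrow}=(\xrightarrow{\tau})^*$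 and $\overset{a}{\Longrightarrow}=(\xrightarrow{\tau})^*\xrightarrow{a}(\xrightarrow{\tau})^*$ for $a\ne\tau$. *)

theory Defs
  imports "HOL-Computational_Algebra.Polynomial"
begin

section \<open>Labelled transition systems and simulations\<close>

type_synonym ('c, 'a) lts = "'c \<Rightarrow> 'a \<Rightarrow> 'c \<Rightarrow> bool"

fun lts_union :: "('c, 'a) lts \<Rightarrow> ('d, 'a) lts \<Rightarrow> ('c + 'd, 'a) lts" where
  "lts_union S T (Inl c) a (Inl d) = S c a d"
| "lts_union S T (Inr c) a (Inr d) = T c a d"
| "lts_union S T _ a _ = False"

definition weak_step :: "('c, 'a) lts \<Rightarrow> 'a \<Rightarrow> 'a \<Rightarrow> 'c \<Rightarrow> 'c \<Rightarrow> bool" where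
  "weak_step T tau a =
     (let silent = (\<lambda>c d. T c tau d)\<^sup>*\<^sup>*
      in if a = tau then silent else silent OO (\<lambda>c d. T c a d) OO silent)"

definition is_strong_simulation :: "('c, 'a) lts \<Rightarrow> ('c \<Rightarrow> 'c \<Rightarrow> bool) \<Rightarrow> bool" where
  "is_strong_simulation T R \<longleftrightarrow>
     (\<forall>c c' a d. R c c' \<longrightarrow> T c a d \<longrightarrow> (\<exists>d'. T c' a d' \<and> R d d'))"

definition is_weak_simulation :: "('c, 'a) lts \<Rightarrow> 'a \<Rightarrow> ('c \<Rightarrow> 'c \<Rightarrow> bool) \<Rightarrow> bool" where
  "is_weak_simulation T tau R \<longleftrightarrow>
     (\<forall>c c' a d. R c c' \<longrightarrow> T c a d \<longrightarrow> (\<exists>d'. weak_step T tau a c' d' \<and> R d d'))"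

text \<open>The largest simulation is the union of all simulations; the lemmas below confirm that
  this union is again a simulation.\<close>

definition strong_sim :: "('c, 'a) lts \<Rightarrow> 'c \<Rightarrow> 'c \<Rightarrow> bool" where
  "strong_sim T c c' \<longleftrightarrow> (\<exists>R. is_strong_simulation T R \<and> R c c')"

definition weak_sim :: "('c, 'a) lts \<Rightarrow> 'a \<Rightarrow> 'c \<Rightarrow> 'c \<Rightarrow> bool" where
  "weak_sim T tau c c' \<longleftrightarrow> (\<exists>R. is_weak_simulation T tau R \<and> R c c')"

lemma strong_sim_largest:
  "is_strong_simulation T (strong_sim T)"
  "is_strong_simulation T R \<Longrightarrow> R \<le> strong_sim T"
proof -
  show "is_strong_simulation T (strong_sim T)"
    unfolding is_strong_simulation_def
  proof (intro allI impI)
    fix c c' a d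
    assume "strong_sim T c c'" and step: "T c a d"
    then obtain R where R: "is_strong_simulation T R" "R c c'"
      by (auto simp: strong_sim_def)
    then obtain d' where "T c' a d'" "R d d'"
      using step unfolding is_strong_simulation_def by metis
    with R(1) show "\<exists>d'. T c' a d' \<and> strong_sim T d d'"
      by (auto simp: strong_sim_def)
  qed
  show "R \<le> strong_sim T" if "is_strong_simulation T R"
    unfolding strong_sim_def by (intro le_funI le_boolI exI[of _ R] conjI that)
qed

lemma weak_sim_largest:
  "is_weak_simulation T tau (weak_sim T tau)"
  "is_weak_simulation T tau R \<Longrightarrow> R \<le> weak_sim T tau"
proof -
  show "is_weak_simulation T tau (weak_sim T tau)"
    unfolding is_weak_simulation_def
  proof (intro allI impI)
    fix c c' a d
    assume "weak_sim T tau c c'" and step: "T c a d"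
    then obtain R where R: "is_weak_simulation T tau R" "R c c'"
      by (auto simp: weak_sim_def)
    then obtain d' where "weak_step T tau a c' d'" "R d d'"
      using step unfolding is_weak_simulation_def by metis
    with R(1) show "\<exists>d'. weak_step T tau a c' d' \<and> weak_sim T tau d d'"
      by (auto simp: weak_sim_def)
  qed
  show "R \<le> weak_sim T tau" if "is_weak_simulation T tau R"
    unfolding weak_sim_def by (intro le_funI le_boolI exI[of _ R] conjI that)
qed


section \<open>One-counter nets and omega-nets\<close>

record ('q, 'a, 'd) net =
  states :: "'q set"
  acts :: "'a set"
  delta :: "('q \<times> 'a \<times> 'd \<times> 'q) set"

datatype effect = Fin int | Omega

definition is_ocn :: "('q, 'a, int) net \<Rightarrow> bool" where
  "is_ocn N \<longleftrightarrow> finite (states N) \<and> finite (acts N) \<and>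
     delta N \<subseteq> states N \<times> acts N \<times> {-1, 0, 1} \<times> states N"

definition is_omega_net :: "('q, 'a, effect) net \<Rightarrow> bool" where
  "is_omega_net N \<longleftrightarrow> finite (states N) \<and> finite (acts N) \<and>
     delta N \<subseteq> states N \<times> acts N \<times> {Fin (-1), Fin 0, Fin 1, Omega} \<times> states N"

fun ocn_lts :: "('q, 'a, int) net \<Rightarrow> ('q \<times> nat, 'a) lts" where
  "ocn_lts N (p, m) a (q, n) \<longleftrightarrow> (\<exists>d. (p, a, d, q) \<in> delta N \<and> int n = int m + d)"

fun omega_lts :: "('q, 'a, effect) net \<Rightarrow> ('q \<times> nat, 'a) lts" where
  "omega_lts N (p, m) a (q, n) \<longleftrightarrow>
     (\<exists>d. (p, a, Fin d, q) \<in> delta N \<and> int n = int m + d) \<or>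
     ((p, a, Omega, q) \<in> delta N \<and> m < n)"


section \<open>Polynomial time\<close>

text \<open>The model of computation is first-order LISP: programs are lists of mutually recursive
  function bodies over binary trees, evaluated call-by-value. Besides one unit per evaluation
  step, reading a variable costs the size of the copied value. Hence no value is larger than the
  time spent on it (\<open>eval_size\<close>), results are not compressed by sharing, and
  polynomial time in this model coincides with polynomial time on Turing machines.\<close>

datatype tree = Leaf | Node tree tree

fun left :: "tree \<Rightarrow> tree" where
  "left Leaf = Leaf"
| "left (Node l r) = l"

fun right :: "tree \<Rightarrow> tree" where
  "right Leaf = Leaf"
| "right (Node l r) = r"

datatype expr =
    EVar nat
  | ENil
  | ECons expr expr
  | EHd expr
  | ETl expr
  | EIf expr expr expr
  | ECall nat "expr list"

type_synonym program = "expr list"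

text \<open>\<open>eval P env e v t\<close>: under the argument list \<open>env\<close> the expression \<open>e\<close> evaluates
  to \<open>v\<close> in time \<open>t\<close>. A conditional tests whether its first argument is not \<open>Leaf\<close>.\<close>

inductive eval :: "program \<Rightarrow> tree list \<Rightarrow> expr \<Rightarrow> tree \<Rightarrow> nat \<Rightarrow> bool"
  and evals :: "program \<Rightarrow> tree list \<Rightarrow> expr list \<Rightarrow> tree list \<Rightarrow> nat \<Rightarrow> bool"
  for P :: program where
  eval_Var: "i < length env \<Longrightarrow> eval P env (EVar i) (env ! i) (1 + size (env ! i))"
| eval_Nil: "eval P env ENil Leaf 1"
| eval_Cons: "eval P env e1 v1 t1 \<Longrightarrow> eval P env e2 v2 t2 \<Longrightarrow>
    eval P env (ECons e1 e2) (Node v1 v2) (1 + t1 + t2)"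
| eval_Hd: "eval P env e v t \<Longrightarrow> eval P env (EHd e) (left v) (1 + t)"
| eval_Tl: "eval P env e v t \<Longrightarrow> eval P env (ETl e) (right v) (1 + t)"
| eval_If_true: "eval P env b u s \<Longrightarrow> u \<noteq> Leaf \<Longrightarrow> eval P env e1 v t \<Longrightarrow>
    eval P env (EIf b e1 e2) v (1 + s + t)"
| eval_If_false: "eval P env b u s \<Longrightarrow> u = Leaf \<Longrightarrow> eval P env e2 v t \<Longrightarrow>
    eval P env (EIf b e1 e2) v (1 + s + t)"
| eval_Call: "f < length P \<Longrightarrow> evals P env es vs s \<Longrightarrow> eval P vs (P ! f) v t \<Longrightarrow>
    eval P env (ECall f es) v (1 + s + t)"
| evals_Nil: "evals P env [] [] 0"
| evals_Cons: "eval P env e v s \<Longrightarrow> evals P env es vs t \<Longrightarrow>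
    evals P env (e # es) (v # vs) (s + t)"

lemma eval_deterministic:
  "eval P env e v t \<Longrightarrow> eval P env e v' t' \<Longrightarrow> v = v' \<and> t = t'"
  "evals P env es vs t \<Longrightarrow> evals P env es vs' t' \<Longrightarrow> vs = vs' \<and> t = t'"
proof (induction arbitrary: v' t' and vs' t' rule: eval_evals.inducts)
  case (eval_Var i env)
  from eval_Var.prems show ?case by cases auto
next
  case (eval_Nil env)
  from eval_Nil.prems show ?case by cases auto
next
  case (eval_Cons env e1 v1 t1 e2 v2 t2)
  from eval_Cons.prems show ?case
    by cases (auto dest!: eval_Cons.IH(2,4))
next
  case (eval_Hd env e v t)
  from eval_Hd.prems show ?case
    by cases (auto dest!: eval_Hd.IH(2))
next
  case (eval_Tl env e v t)
  from eval_Tl.prems show ?case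
    by cases (auto dest!: eval_Tl.IH(2))
next
  case (eval_If_true env b u s e1 v t e2)
  from eval_If_true.prems show ?case
    by cases (use eval_If_true.hyps in \<open>auto dest!: eval_If_true.IH(2,4)\<close>)
next
  case (eval_If_false env b u s e2 v t e1)
  from eval_If_false.prems show ?case
    by cases (use eval_If_false.hyps in \<open>auto dest!: eval_If_false.IH(2,4)\<close>)
next
  case (eval_Call f env es vs s v t)
  from eval_Call.prems show ?case
    by cases (auto dest!: eval_Call.IH(3,5))
next
  case (evals_Nil env)
  from evals_Nil.prems show ?case by cases auto
next
  case (evals_Cons env e v s es vs t)
  from evals_Cons.prems show ?case
    by cases (auto dest!: evals_Cons.IH(2,4))
qed

lemma eval_size:
  "eval P env e v t \<Longrightarrow> size v \<le> t"
  "evals P env es vs t \<Longrightarrow> True"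
proof (induction rule: eval_evals.inducts)
  case (eval_Hd env e v t)
  then show ?case by (cases v) auto
next
  case (eval_Tl env e v t)
  then show ?case by (cases v) auto
qed auto

text \<open>Function 0 is the entry point.\<close>

definition runs_to :: "program \<Rightarrow> tree \<Rightarrow> tree \<Rightarrow> nat \<Rightarrow> bool" where
  "runs_to P x y t \<longleftrightarrow> eval P [x] (ECall 0 [EVar 0]) y t"

definition polytime_on :: "tree set \<Rightarrow> (tree \<Rightarrow> tree) \<Rightarrow> bool" where
  "polytime_on A f \<longleftrightarrow>
     (\<exists>(P :: program) (p :: nat poly). \<forall>x\<in>A. \<exists>t \<le> poly p (size x). runs_to P x (f x) t)"


section \<open>Encoding of nets\<close>

text \<open>Control states and actions of nets given to or produced by an algorithm are named by trees.
  A finite set is encoded by any list of its elements, so a net has many encodings.\<close>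

fun enc_list :: "tree list \<Rightarrow> tree" where
  "enc_list [] = Leaf"
| "enc_list (x # xs) = Node x (enc_list xs)"

text \<open>Only meant for the effects -1, 0, 1, on which it is injective.\<close>

definition enc_int :: "int \<Rightarrow> tree" where
  "enc_int d = (if d = 0 then Leaf
                else if d = 1 then Node Leaf Leaf
                else Node Leaf (Node Leaf Leaf))"

fun enc_effect :: "effect \<Rightarrow> tree" where
  "enc_effect (Fin d) = enc_int d"
| "enc_effect Omega = Node (Node Leaf Leaf) Leaf"

fun enc_trans :: "('d \<Rightarrow> tree) \<Rightarrow> tree \<times> tree \<times> 'd \<times> tree \<Rightarrow> tree" where
  "enc_trans enc (p, a, d, q) = Node p (Node a (Node (enc d) q))"

definition encodes_net :: "('d \<Rightarrow> tree) \<Rightarrow> tree \<Rightarrow> (tree, tree, 'd) net \<Rightarrow> bool" where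
  "encodes_net enc x N \<longleftrightarrow>
     (\<exists>Qs As Ds. set Qs = states N \<and> set As = acts N \<and> set Ds = delta N \<and>
        x = Node (enc_list Qs) (Node (enc_list As) (enc_list (map (enc_trans enc) Ds))))"

definition encodes_ocns ::
  "tree \<Rightarrow> (tree, tree, int) net \<Rightarrow> (tree, tree, int) net \<Rightarrow> bool" where
  "encodes_ocns z N N' \<longleftrightarrow>
     (\<exists>x x'. z = Node x x' \<and> encodes_net enc_int x N \<and> encodes_net enc_int x' N')"

definition encodes_ocn_omega ::
  "tree \<Rightarrow> (tree, tree, int) net \<Rightarrow> (tree, tree, effect) net \<Rightarrow> bool" where
  "encodes_ocn_omega z M M' \<longleftrightarrow>
     (\<exists>y y'. z = Node y y' \<and> encodes_net enc_int y M \<and> encodes_net enc_effect y' M')"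

end

theory Submission
  imports Defs
begin

text \<open>Each round of the weak simulation game becomes a block of strong rounds. After announcing an
  action, Spoiler plays a fixed polynomial number of auxiliary steps and an end-of-round step; in the
  auxiliary steps Duplicator performs, one by one, the transitions of the weak response.

  Duplicator stores in the control state the height of the counter above its minimum since the last
  visible step. A height equal to the number of control states proves, by the pigeonhole principle
  applied to the levels passed on the way up, that a silent cycle with positive effect was available;
  the counter could have been made arbitrarily large, which an \<open>Omega\<close> step imitates. As long as
  this height is not reached, a repetition of state and height never raises the counter and can be
  cut out; after an \<open>Omega\<close> step any path in the control graph can be followed. Hence polynomially
  many auxiliary steps suffice.\<close>

section \<open>Polynomial-time functions on trees\<close>

text \<open>The obstacle is that one weak step hides a silent run of unbounded length and an
  unbounded choice of the final counter, while the length of a round must not depend on the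
  counters. Approximate play is good enough because nets cannot test for zero: a larger counter
  never harms Duplicator. So for soundness the auxiliary play need only be dominated by a genuine
  weak step, and for completeness it need only end at or above the intended counter, in exactly the
  length of a round.

  The parameters are trees at hand, so that no numbers have to be computed. The whole input
  \<open>z\<close> marks the new control states, being at least as large as every name inside it.
  The state list of the second net is the top height \<open>F\<close>; heights are its suffixes, so
  a decrement is \<open>right\<close>. Spoiler's clock \<open>K\<close> is the encoded transition
  list of the Duplicator net itself: each state and each transition contributes to it once per
  height, which already makes it longer than any response has to be.\<close>

lemma poly_mono_nat: "x \<le> y \<Longrightarrow> poly (p :: nat poly) x \<le> poly p y"
  by (induction p) (auto intro!: add_mono mult_mono)

definition total_size :: "tree list \<Rightarrow> nat" where
  "total_size vs = sum_list (map size vs)"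

lemma total_size_simps [simp]:
  "total_size [] = 0" "total_size (v # vs) = size v + total_size vs"
  by (simp_all add: total_size_def)

lemma evals_total_size: "evals P env es vs t \<Longrightarrow> total_size vs \<le> t"
proof (induction es arbitrary: vs t)
  case Nil
  then show ?case by cases auto
next
  case (Cons e es)
  from Cons.prems show ?case
    by cases (use Cons.IH eval_size(1) in \<open>fastforce intro: add_mono\<close>)
qed

lemma evals_vars:
  "\<forall>i\<in>set is. i < length env \<Longrightarrow>
    evals P env (map EVar is) (map ((!) env) is) (length is + total_size (map ((!) env) is))"
proof (induction "is")
  case Nil
  show ?case by (simp add: evals_Nil)
next
  case (Cons i js)
  then have "evals P env (EVar i # map EVar js) (env ! i # map ((!) env) js)
      ((1 + size (env ! i)) + (length js + total_size (map ((!) env) js)))"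
    by (intro evals_Cons eval_Var) auto
  then show ?case by (simp add: algebra_simps)
qed

lemma evals_all_vars: "evals P vs (map EVar [0..<length vs]) vs (length vs + total_size vs)"
  using evals_vars[of "[0..<length vs]" vs P] by (simp add: map_nth)

lemma evals_tail_vars:
  "evals P (v # vs) (map EVar [1..<Suc (length vs)]) vs (length vs + total_size vs)"
proof -
  have "map ((!) (v # vs)) [1..<Suc (length vs)] = vs"
    by (rule nth_equalityI) (auto simp del: upt_Suc)
  then show ?thesis
    using evals_vars[of "[1..<Suc (length vs)]" "v # vs" P] by (auto simp del: upt_Suc)
qed

text \<open>Polynomial-time functions of \<open>n\<close> arguments. The code may be placed at any position of any
  larger program, so pieces of code are combined without renumbering calls.\<close>

definition fp :: "nat \<Rightarrow> (tree list \<Rightarrow> tree) \<Rightarrow> bool" where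
  "fp n F \<longleftrightarrow> (\<forall>k. \<exists>P e p. \<forall>P0 Q vs. length P0 = k \<longrightarrow> length vs = n \<longrightarrow>
     (\<exists>t \<le> poly p (total_size vs). eval (P0 @ P @ Q) vs e (F vs) t))"

lemma fpI:
  assumes "\<And>k. \<exists>P e p. \<forall>P0 Q vs. length P0 = k \<longrightarrow> length vs = n \<longrightarrow>
     (\<exists>t \<le> poly p (total_size vs). eval (P0 @ P @ Q) vs e (F vs) t)"
  shows "fp n F"
  using assms unfolding fp_def by blast

lemma fpE:
  assumes "fp n F"
  obtains P e p where "\<And>P0 Q vs. length P0 = k \<Longrightarrow> length vs = n \<Longrightarrow>
     \<exists>t \<le> poly p (total_size vs). eval (P0 @ P @ Q) vs e (F vs) t"
  using assms unfolding fp_def by meson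

lemma fp_cong: "fp n F \<Longrightarrow> (\<And>vs. length vs = n \<Longrightarrow> F vs = G vs) \<Longrightarrow> fp n G"
  unfolding fp_def by metis

lemma fp_size:
  assumes "fp n F"
  obtains q where "\<And>vs. length vs = n \<Longrightarrow> size (F vs) \<le> poly q (total_size vs)"
proof -
  obtain P e p where *: "\<And>P0 Q vs. length P0 = (0::nat) \<Longrightarrow> length vs = n \<Longrightarrow>
     \<exists>t \<le> poly p (total_size vs). eval (P0 @ P @ Q) vs e (F vs) t"
    by (rule fpE[OF assms]) (rule that, assumption)
  show ?thesis
  proof (rule that)
    fix vs :: "tree list" assume "length vs = n"
    with *[of "[]" vs "[]"] obtain t where
      "t \<le> poly p (total_size vs)" "eval P vs e (F vs) t" by auto
    then show "size (F vs) \<le> poly p (total_size vs)"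
      using eval_size(1) by fastforce
  qed
qed

section \<open>Closure under program constructors and composition\<close>

lemma fp_var: "i < n \<Longrightarrow> fp n (\<lambda>vs. vs ! i)"
proof (rule fpI, rule exI[of _ "[]"], rule exI[of _ "EVar i"], rule exI[of _ "[:1, 1:]"],
    intro allI impI)
  fix k :: nat and P0 Q :: program and vs :: "tree list" assume "i < n" "length vs = n"
  moreover from this have "size (vs ! i) \<le> total_size vs"
    by (simp add: total_size_def elem_le_sum_list[of i "map size vs", simplified])
  ultimately show "\<exists>t \<le> poly [:1, 1:] (total_size vs). eval (P0 @ [] @ Q) vs (EVar i) (vs ! i) t"
    by (intro exI[of _ "1 + size (vs ! i)"] conjI eval_Var) auto
qed

lemma fp_leaf: "fp n (\<lambda>vs. Leaf)"
  by (rule fpI, rule exI[of _ "[]"], rule exI[of _ ENil], rule exI[of _ "[:1:]"])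
    (use eval_Nil in fastforce)

lemma fp_node:
  assumes "fp n F" "fp n G"
  shows "fp n (\<lambda>vs. Node (F vs) (G vs))"
proof (rule fpI)
  fix k
  obtain P e p where F: "\<And>P0 Q vs. length P0 = k \<Longrightarrow> length vs = n \<Longrightarrow>
     \<exists>t \<le> poly p (total_size vs). eval (P0 @ P @ Q) vs e (F vs) t"
    by (rule fpE[OF assms(1)]) (rule that, assumption)
  \<comment> \<open>The second piece is compiled for the offset right behind the first, so the calls
    in both pieces are correct absolute positions in the joint program.\<close>
  obtain P' e' p' where G: "\<And>P0 Q vs. length P0 = k + length P \<Longrightarrow> length vs = n \<Longrightarrow>
     \<exists>t \<le> poly p' (total_size vs). eval (P0 @ P' @ Q) vs e' (G vs) t"
    by (rule fpE[OF assms(2)]) (rule that, assumption)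
  show "\<exists>P e p. \<forall>P0 Q vs. length P0 = k \<longrightarrow> length vs = n \<longrightarrow>
     (\<exists>t \<le> poly p (total_size vs). eval (P0 @ P @ Q) vs e (Node (F vs) (G vs)) t)"
  proof (intro exI[of _ "P @ P'"] exI[of _ "ECons e e'"] exI[of _ "1 + p + p'"] allI impI)
    fix P0 Q :: program and vs :: "tree list" assume "length P0 = k" "length vs = n"
    with F[of P0 vs "P' @ Q"] G[of "P0 @ P" vs Q] obtain t t' where
      "t \<le> poly p (total_size vs)" "eval (P0 @ (P @ P') @ Q) vs e (F vs) t"
      "t' \<le> poly p' (total_size vs)" "eval (P0 @ (P @ P') @ Q) vs e' (G vs) t'"
      by auto
    then show "\<exists>t \<le> poly (1 + p + p') (total_size vs).
        eval (P0 @ (P @ P') @ Q) vs (ECons e e') (Node (F vs) (G vs)) t"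
      by (intro exI[of _ "1 + t + t'"] conjI eval_Cons) auto
  qed
qed

lemma fp_if:
  assumes "fp n B" "fp n F" "fp n G"
  shows "fp n (\<lambda>vs. if B vs \<noteq> Leaf then F vs else G vs)"
proof (rule fpI)
  fix k
  obtain P1 e1 p1 where B: "\<And>P0 Q vs. length P0 = k \<Longrightarrow> length vs = n \<Longrightarrow>
     \<exists>t \<le> poly p1 (total_size vs). eval (P0 @ P1 @ Q) vs e1 (B vs) t"
    by (rule fpE[OF assms(1)]) (rule that, assumption)
  obtain P2 e2 p2 where F: "\<And>P0 Q vs. length P0 = k + length P1 \<Longrightarrow> length vs = n \<Longrightarrow>
     \<exists>t \<le> poly p2 (total_size vs). eval (P0 @ P2 @ Q) vs e2 (F vs) t"
    by (rule fpE[OF assms(2)]) (rule that, assumption)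
  obtain P3 e3 p3 where G: "\<And>P0 Q vs. length P0 = k + length P1 + length P2 \<Longrightarrow>
     length vs = n \<Longrightarrow> \<exists>t \<le> poly p3 (total_size vs). eval (P0 @ P3 @ Q) vs e3 (G vs) t"
    by (rule fpE[OF assms(3)]) (rule that, assumption)
  show "\<exists>P e p. \<forall>P0 Q vs. length P0 = k \<longrightarrow> length vs = n \<longrightarrow>
     (\<exists>t \<le> poly p (total_size vs). eval (P0 @ P @ Q) vs e (if B vs \<noteq> Leaf then F vs else G vs) t)"
  proof (intro exI[of _ "P1 @ P2 @ P3"] exI[of _ "EIf e1 e2 e3"] exI[of _ "1 + p1 + p2 + p3"]
      allI impI)
    fix P0 Q :: program and vs :: "tree list" assume "length P0 = k" "length vs = n"
    with B[of P0 vs "P2 @ P3 @ Q"] F[of "P0 @ P1" vs "P3 @ Q"] G[of "P0 @ P1 @ P2" vs Q]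
    obtain t1 t2 t3 where
      "t1 \<le> poly p1 (total_size vs)" "eval (P0 @ (P1 @ P2 @ P3) @ Q) vs e1 (B vs) t1"
      "t2 \<le> poly p2 (total_size vs)" "eval (P0 @ (P1 @ P2 @ P3) @ Q) vs e2 (F vs) t2"
      "t3 \<le> poly p3 (total_size vs)" "eval (P0 @ (P1 @ P2 @ P3) @ Q) vs e3 (G vs) t3"
      by auto
    note ts = this
    show "\<exists>t \<le> poly (1 + p1 + p2 + p3) (total_size vs). eval (P0 @ (P1 @ P2 @ P3) @ Q) vs
        (EIf e1 e2 e3) (if B vs \<noteq> Leaf then F vs else G vs) t"
    proof (cases "B vs = Leaf")
      case True
      with eval_If_false[OF ts(2) True ts(6), of e2] ts show ?thesis
        by (intro exI[of _ "1 + t1 + t3"]) auto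
    next
      case False
      with eval_If_true[OF ts(2) False ts(4), of e3] ts show ?thesis
        by (intro exI[of _ "1 + t1 + t2"]) auto
    qed
  qed
qed

lemma fp_list:
  assumes "\<forall>F\<in>set Fs. fp n F"
  shows "\<exists>P es p. \<forall>P0 Q vs. length P0 = k \<longrightarrow> length vs = n \<longrightarrow>
     (\<exists>t \<le> poly p (total_size vs). evals (P0 @ P @ Q) vs es (map (\<lambda>F. F vs) Fs) t)"
  using assms
proof (induction Fs arbitrary: k)
  case Nil
  show ?case
    by (rule exI[of _ "[]"], rule exI[of _ "[]"], rule exI[of _ 0], intro allI impI)
      (simp add: evals_Nil)
next
  case (Cons F Fs)
  from Cons.prems have "fp n F" by simp
  then obtain P e p where F: "\<And>P0 Q vs. length P0 = k \<Longrightarrow> length vs = n \<Longrightarrow>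
     \<exists>t \<le> poly p (total_size vs). eval (P0 @ P @ Q) vs e (F vs) t"
    by (rule fpE) (rule that, assumption)
  obtain P' es p' where G: "\<And>P0 Q vs. length P0 = k + length P \<Longrightarrow> length vs = n \<Longrightarrow>
     \<exists>t \<le> poly p' (total_size vs). evals (P0 @ P' @ Q) vs es (map (\<lambda>F. F vs) Fs) t"
    using Cons.IH[of "k + length P"] Cons.prems by (metis list.set_intros(2))
  show ?case
  proof (rule exI[of _ "P @ P'"], rule exI[of _ "e # es"], rule exI[of _ "p + p'"], intro allI impI)
    fix P0 Q :: program and vs :: "tree list" assume "length P0 = k" "length vs = n"
    with F[of P0 vs "P' @ Q"] G[of "P0 @ P" vs Q] obtain t t' where
      "t \<le> poly p (total_size vs)" "eval (P0 @ (P @ P') @ Q) vs e (F vs) t"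
      "t' \<le> poly p' (total_size vs)" "evals (P0 @ (P @ P') @ Q) vs es (map (\<lambda>F. F vs) Fs) t'"
      by auto
    then show "\<exists>t \<le> poly (p + p') (total_size vs).
        evals (P0 @ (P @ P') @ Q) vs (e # es) (map (\<lambda>F. F vs) (F # Fs)) t"
      by (intro exI[of _ "t + t'"] conjI) (auto intro: evals_Cons)
  qed
qed

text \<open>The body of \<open>G\<close> becomes a function of its own, because only a call replaces
  the argument list. It stands between the code computing the arguments and the code that it calls
  itself.\<close>

lemma fp_comp:
  assumes G: "fp m G" and Fs: "\<forall>F\<in>set Fs. fp n F" and m: "length Fs = m"
  shows "fp n (\<lambda>vs. G (map (\<lambda>F. F vs) Fs))"
proof (rule fpI)
  fix k
  obtain P es p where 1: "\<And>P0 Q vs. length P0 = k \<Longrightarrow> length vs = n \<Longrightarrow>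
     \<exists>t \<le> poly p (total_size vs). evals (P0 @ P @ Q) vs es (map (\<lambda>F. F vs) Fs) t"
    using fp_list[OF Fs] by metis
  obtain P' e p' where 2: "\<And>P0 Q vs. length P0 = Suc (k + length P) \<Longrightarrow> length vs = m \<Longrightarrow>
     \<exists>t \<le> poly p' (total_size vs). eval (P0 @ P' @ Q) vs e (G vs) t"
    by (rule fpE[OF G]) (rule that, assumption)
  show "\<exists>P e p. \<forall>P0 Q vs. length P0 = k \<longrightarrow> length vs = n \<longrightarrow>
     (\<exists>t \<le> poly p (total_size vs). eval (P0 @ P @ Q) vs e (G (map (\<lambda>F. F vs) Fs)) t)"
  proof (intro exI[of _ "P @ [e] @ P'"] exI[of _ "ECall (k + length P) es"]
      exI[of _ "1 + p + pcompose p' p"] allI impI)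
    fix P0 Q :: program and vs :: "tree list" assume P0: "length P0 = k" and vs: "length vs = n"
    let ?ws = "map (\<lambda>F. F vs) Fs" and ?P = "P0 @ (P @ [e] @ P') @ Q"
    from 1[OF P0 vs, of "[e] @ P' @ Q"] obtain s where
      s: "s \<le> poly p (total_size vs)" "evals ?P vs es ?ws s" by auto
    from 2[of "P0 @ P @ [e]" ?ws Q] P0 m obtain t where
      t: "t \<le> poly p' (total_size ?ws)" "eval ?P ?ws e (G ?ws) t" by auto
    \<comment> \<open>Arguments are no larger than the time spent on computing them; this is why the
      two polynomials can be composed.\<close>
    have "total_size ?ws \<le> poly p (total_size vs)"
      using evals_total_size[OF s(2)] s(1) by simp
    then have "t \<le> poly p' (poly p (total_size vs))"
      using t(1) poly_mono_nat le_trans by blast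
    moreover have "?P ! (k + length P) = e"
      using P0 by (simp add: nth_append)
    then have "eval ?P vs (ECall (k + length P) es) (G ?ws) (1 + s + t)"
      using P0 s(2) t(2) by (intro eval_Call) auto
    ultimately show "\<exists>t \<le> poly (1 + p + pcompose p' p) (total_size vs).
        eval ?P vs (ECall (k + length P) es) (G ?ws) t"
      using s(1) by (intro exI[of _ "1 + s + t"]) (auto simp: poly_pcompose)
  qed
qed

lemma fp_comp1: "fp 1 (\<lambda>vs. g (vs ! 0)) \<Longrightarrow> fp n F \<Longrightarrow> fp n (\<lambda>vs. g (F vs))"
  using fp_comp[of 1 "\<lambda>vs. g (vs ! 0)" "[F]" n] by simp

lemma fp_left: "fp n F \<Longrightarrow> fp n (\<lambda>vs. left (F vs))"
proof (rule fp_comp1[of left], rule fpI, rule exI[of _ "[]"], rule exI[of _ "EHd (EVar 0)"],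
    rule exI[of _ "[:2, 1:]"], intro allI impI)
  fix k :: nat and P0 Q :: program and vs :: "tree list" assume "length vs = 1"
  then show "\<exists>t \<le> poly [:2, 1:] (total_size vs).
      eval (P0 @ [] @ Q) vs (EHd (EVar 0)) (left (vs ! 0)) t"
    by (intro exI[of _ "1 + (1 + size (vs ! 0))"] conjI eval_Hd eval_Var) (auto simp: length_Suc_conv)
qed

lemma fp_right: "fp n F \<Longrightarrow> fp n (\<lambda>vs. right (F vs))"
proof (rule fp_comp1[of right], rule fpI, rule exI[of _ "[]"], rule exI[of _ "ETl (EVar 0)"],
    rule exI[of _ "[:2, 1:]"], intro allI impI)
  fix k :: nat and P0 Q :: program and vs :: "tree list" assume "length vs = 1"
  then show "\<exists>t \<le> poly [:2, 1:] (total_size vs).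
      eval (P0 @ [] @ Q) vs (ETl (EVar 0)) (right (vs ! 0)) t"
    by (intro exI[of _ "1 + (1 + size (vs ! 0))"] conjI eval_Tl eval_Var) (auto simp: length_Suc_conv)
qed

lemma fp_const: "fp n (\<lambda>vs. c)"
  by (induction c) (auto intro: fp_leaf fp_node)

text \<open>The comparison is unfolded along the fixed tree \<open>c\<close> when the program is
  built, so equality of two computed trees never has to be decided. Apart from emptiness tests, the
  translation compares only with \<open>tau\<close>.\<close>

lemma fp_if_eq:
  assumes "fp n A" "fp n F" "fp n G"
  shows "fp n (\<lambda>vs. if A vs = c then F vs else G vs)"
  using assms
proof (induction c arbitrary: A F G)
  case Leaf
  have "fp n (\<lambda>vs. if A vs \<noteq> Leaf then G vs else F vs)"
    using Leaf by (intro fp_if)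
  then show ?case by (rule fp_cong) auto
next
  case (Node l r)
  have "fp n (\<lambda>vs. if A vs \<noteq> Leaf
      then if left (A vs) = l then if right (A vs) = r then F vs else G vs else G vs else G vs)"
    using Node.prems by (intro fp_if Node.IH fp_left fp_right)
  moreover have "x = Node l r \<longleftrightarrow> x \<noteq> Leaf \<and> left x = l \<and> right x = r" for x
    by (cases x) auto
  ultimately show ?case by (elim fp_cong) auto
qed

section \<open>Recursion along lists\<close>

primrec spine_fold :: "(tree \<Rightarrow> tree \<Rightarrow> tree) \<Rightarrow> tree \<Rightarrow> tree \<Rightarrow> tree" where
  "spine_fold g b Leaf = b"
| "spine_fold g b (Node l r) = g (Node l r) (spine_fold g b r)"

text \<open>Recursion along the right spine is only polynomial because each step adds to the
  intermediate result a term whose size does not depend on that result.\<close>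

lemma fp_spine_fold_var:
  assumes G: "fp (Suc (Suc n)) G" and B: "fp n B"
    and grow: "\<And>r x vs. length vs = n \<Longrightarrow>
      size (G (r # x # vs)) \<le> size r + poly q (size x + total_size vs)"
  shows "fp (Suc n) (\<lambda>vs. spine_fold (\<lambda>x r. G (r # x # tl vs)) (B (tl vs)) (hd vs))"
proof (rule fpI)
  fix k
  let ?R = "\<lambda>vs. spine_fold (\<lambda>x r. G (r # x # vs)) (B vs)"
  obtain PG eG pG where evG: "\<And>P0 Q vs. length P0 = k + 3 \<Longrightarrow> length vs = Suc (Suc n) \<Longrightarrow>
     \<exists>t \<le> poly pG (total_size vs). eval (P0 @ PG @ Q) vs eG (G vs) t"
    by (rule fpE[OF G]) (rule that, assumption)
  obtain PB eB pB where evB: "\<And>P0 Q vs. length P0 = k + 3 + length PG \<Longrightarrow> length vs = n \<Longrightarrow>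
     \<exists>t \<le> poly pB (total_size vs). eval (P0 @ PB @ Q) vs eB (B vs) t"
    by (rule fpE[OF B]) (rule that, assumption)
  obtain qB where qB: "\<And>vs. length vs = n \<Longrightarrow> size (B vs) \<le> poly qB (total_size vs)"
    using fp_size[OF B] by blast
  \<comment> \<open>Three slots: the loop at \<open>k\<close>, the step \<open>G\<close> at
    \<open>k + 1\<close>, the base \<open>B\<close> at \<open>k + 2\<close>; hence the remaining
    code starts at \<open>k + 3\<close>. Argument 0 of the loop is the list still to be
    traversed.\<close>
  define body where "body = EIf (EVar 0)
     (ECall (k + 1) (ECall k (ETl (EVar 0) # map EVar [1..<Suc n]) # map EVar [0..<Suc n]))
     (ECall (k + 2) (map EVar [1..<Suc n]))"
  \<comment> \<open>For total argument size \<open>X\<close>: \<open>rb\<close> bounds every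
    intermediate result (the base plus at most \<open>X\<close> increments), \<open>w\<close> the
    cost of one unfolding apart from its recursive call, and \<open>p\<close> the initial call with
    at most \<open>X + 1\<close> unfoldings. \<open>G\<close> also reads the intermediate result,
    hence \<open>rb\<close> inside \<open>pG\<close>.\<close>
  define rb where "rb = qB + [:0, 1:] * q"
  define w where "w = [:8 + 4 * n:] + [:0, 6:] + pB + pcompose pG (rb + [:0, 1:])"
  define p where "p = [:1 + Suc n:] + [:0, 1:] + [:1, 1:] * w"
  have rbound: "size (?R vs x) \<le> poly rb X"
    if "length vs = n" "size x + total_size vs \<le> X" for vs x X
  proof -
    have "size (?R vs x) \<le> poly qB X + size x * poly q X"
      using that(2)
    proof (induction x)
      case Leaf
      then have "poly qB (total_size vs) \<le> poly qB X"
        by (intro poly_mono_nat) simp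
      then show ?case using qB[OF that(1)] by auto
    next
      case (Node l r)
      then have "size (?R vs r) \<le> poly qB X + size r * poly q X" by simp
      moreover have "poly q (size (Node l r) + total_size vs) \<le> poly q X"
        by (rule poly_mono_nat) (fact Node.prems)
      ultimately have "size (?R vs (Node l r)) \<le> poly qB X + size r * poly q X + poly q X"
        using grow[OF that(1), of "?R vs r" "Node l r"] by simp
      also have "\<dots> \<le> poly qB X + size (Node l r) * poly q X"
        by (simp add: algebra_simps)
      finally show ?case .
    qed
    also have "\<dots> \<le> poly rb X"
      using that(2) by (simp add: rb_def mult_right_mono)
    finally show ?thesis .
  qed
  show "\<exists>P e p. \<forall>P0 Q vs. length P0 = k \<longrightarrow> length vs = Suc n \<longrightarrow>
     (\<exists>t \<le> poly p (total_size vs). eval (P0 @ P @ Q) vs e (?R (tl vs) (hd vs)) t)"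
  proof (intro exI[of _ "[body, eG, eB] @ PG @ PB"] exI[of _ "ECall k (map EVar [0..<Suc n])"]
      exI[of _ p] allI impI)
    fix P0 Q :: program and us :: "tree list" assume P0: "length P0 = k" and us: "length us = Suc n"
    then obtain x0 vs where xv: "us = x0 # vs" "length vs = n" by (cases us) auto
    define P where "P = P0 @ ([body, eG, eB] @ PG @ PB) @ Q"
    have nth: "P ! k = body" "P ! (k + 1) = eG" "P ! (k + 2) = eB"
      and len: "k < length P" "k + 1 < length P" "k + 2 < length P"
      using P0 by (auto simp: P_def nth_append)
    define X where "X = total_size us"
    have main: "\<exists>t \<le> (size x + 1) * poly w X. eval P (x # vs) body (?R vs x) t"
      if "size x + total_size vs \<le> X" for x
      using that
    proof (induction x)
      case Leaf
      from evB[of "P0 @ [body, eG, eB] @ PG" vs Q] P0 xv obtain t where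
        t: "t \<le> poly pB (total_size vs)" "eval P vs eB (B vs) t" by (auto simp: P_def)
      have "poly pB (total_size vs) \<le> poly pB X"
        using Leaf by (intro poly_mono_nat) simp
      moreover have "eval P (Leaf # vs) body (B vs)
          (1 + (1 + size Leaf) + (1 + (n + total_size vs) + t))"
        unfolding body_def
      proof (rule eval_If_false)
        show "eval P (Leaf # vs) (EVar 0) Leaf (1 + size Leaf)"
          using eval_Var[of 0 "Leaf # vs" P] by simp
        show "eval P (Leaf # vs) (ECall (k + 2) (map EVar [1..<Suc n])) (B vs)
            (1 + (n + total_size vs) + t)"
          using evals_tail_vars[of P Leaf vs] xv nth len t(2) by (intro eval_Call) auto
      qed simp
      ultimately show ?case
        using t(1) Leaf by (intro exI[of _ "1 + (1 + size Leaf) + (1 + (n + total_size vs) + t)"])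
          (auto simp: w_def poly_pcompose)
    next
      case (Node l r)
      let ?x = "Node l r"
      from Node obtain t1 where
        t1: "t1 \<le> (size r + 1) * poly w X" "eval P (r # vs) body (?R vs r) t1" by auto
      from evG[of "P0 @ [body, eG, eB]" "?R vs r # ?x # vs" "PB @ Q"] P0 xv obtain t2 where
        t2: "t2 \<le> poly pG (total_size (?R vs r # ?x # vs))"
          "eval P (?R vs r # ?x # vs) eG (G (?R vs r # ?x # vs)) t2" by (auto simp: P_def)
      have "size (?R vs r) \<le> poly rb X"
        using Node.prems by (intro rbound[OF xv(2)]) simp
      then have "poly pG (total_size (?R vs r # ?x # vs)) \<le> poly pG (poly rb X + X)"
        using Node.prems by (intro poly_mono_nat) simp
      then have t2': "t2 \<le> poly pG (poly rb X + X)" using t2(1) by simp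
      let ?ta = "1 + ((1 + (1 + size ?x)) + (n + total_size vs)) + t1"
      have "eval P (?x # vs) (ECall k (ETl (EVar 0) # map EVar [1..<Suc n])) (?R vs r) ?ta"
      proof (rule eval_Call)
        have "eval P (?x # vs) (EVar 0) ?x (1 + size ?x)"
          using eval_Var[of 0 "?x # vs" P] by simp
        then show "evals P (?x # vs) (ETl (EVar 0) # map EVar [1..<Suc n]) (r # vs)
            ((1 + (1 + size ?x)) + (n + total_size vs))"
          using evals_tail_vars[of P ?x vs] xv by (intro evals_Cons) (auto dest: eval_Tl)
      qed (use t1 nth len in auto)
      moreover have "evals P (?x # vs) (map EVar [0..<Suc n]) (?x # vs)
          (Suc n + total_size (?x # vs))"
        using evals_all_vars[of P "?x # vs"] xv by (simp del: upt_Suc)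
      ultimately have "evals P (?x # vs)
        (ECall k (ETl (EVar 0) # map EVar [1..<Suc n]) # map EVar [0..<Suc n])
        (?R vs r # ?x # vs) (?ta + (Suc n + total_size (?x # vs)))"
        by (rule evals_Cons)
      then have "eval P (?x # vs)
        (ECall (k + 1) (ECall k (ETl (EVar 0) # map EVar [1..<Suc n]) # map EVar [0..<Suc n]))
        (G (?R vs r # ?x # vs)) (1 + (?ta + (Suc n + total_size (?x # vs))) + t2)"
        by (rule eval_Call[OF len(2)]) (use nth t2(2) in simp)
      moreover have "eval P (?x # vs) (EVar 0) ?x (1 + size ?x)"
        using eval_Var[of 0 "?x # vs" P] by simp
      ultimately have ev: "eval P (?x # vs) body (?R vs ?x)
          (1 + (1 + size ?x) + (1 + (?ta + (Suc n + total_size (?x # vs))) + t2))"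
        unfolding body_def by (intro eval_If_true) auto
      have "1 + (1 + size ?x) + (1 + (?ta + (Suc n + total_size (?x # vs))) + t2)
          \<le> poly w X + t1"
        using t2' Node.prems by (auto simp: w_def poly_pcompose)
      also have "\<dots> \<le> poly w X + (size r + 1) * poly w X" using t1(1) by simp
      also have "\<dots> \<le> (size ?x + 1) * poly w X" by (simp add: algebra_simps)
      finally show ?case using ev by blast
    qed
    obtain t where t: "t \<le> (size x0 + 1) * poly w X" "eval P us body (?R vs x0) t"
      using main[of x0] xv by (auto simp: X_def)
    have "eval P us (ECall k (map EVar [0..<Suc n])) (?R vs x0) (1 + (Suc n + total_size us) + t)"
      using evals_all_vars[of P us] us nth len t(2) by (intro eval_Call) auto
    moreover have "(size x0 + 1) * poly w X \<le> (X + 1) * poly w X"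
      by (intro mult_right_mono) (auto simp: X_def xv)
    then have "t \<le> (X + 1) * poly w X" using t(1) by (rule order_trans[rotated])
    then have "1 + (Suc n + total_size us) + t \<le> poly p (total_size us)"
      by (simp add: p_def X_def algebra_simps)
    ultimately show "\<exists>t \<le> poly p (total_size us).
        eval (P0 @ ([body, eG, eB] @ PG @ PB) @ Q) us (ECall k (map EVar [0..<Suc n]))
          (?R (tl us) (hd us)) t"
      using xv by (auto simp: P_def)
  qed
qed

lemma fp_spine_fold:
  assumes "fp (Suc (Suc n)) G" "fp n B" "fp n X"
    and "\<And>r x vs. length vs = n \<Longrightarrow>
      size (G (r # x # vs)) \<le> size r + poly q (size x + total_size vs)"
  shows "fp n (\<lambda>vs. spine_fold (\<lambda>x r. G (r # x # vs)) (B vs) (X vs))"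
proof -
  have "fp n (\<lambda>vs. (\<lambda>vs. spine_fold (\<lambda>x r. G (r # x # tl vs)) (B (tl vs)) (hd vs))
      (map (\<lambda>F. F vs) (X # map (\<lambda>i vs. vs ! i) [0..<n])))"
    by (rule fp_comp[OF fp_spine_fold_var[OF assms(1,2,4)]]) (auto intro: fp_var assms(3))
  then show ?thesis
    by (rule fp_cong) (auto simp: comp_def map_nth)
qed

definition spine_append :: "tree \<Rightarrow> tree \<Rightarrow> tree" where
  "spine_append x y = spine_fold (\<lambda>s r. Node (left s) r) y x"

lemma spine_append_simps [simp]:
  "spine_append Leaf y = y"
  "spine_append (Node l r) y = Node l (spine_append r y)"
  by (simp_all add: spine_append_def)

text \<open>Exactly additive because \<open>Leaf\<close> has size 0. This is the growth condition
  under which \<open>spine_concat\<close> is an admissible fold.\<close>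

lemma size_spine_append: "size (spine_append x y) = size x + size y"
  by (induction x) auto

lemma fp_spine_append:
  assumes "fp n F" "fp n G"
  shows "fp n (\<lambda>vs. spine_append (F vs) (G vs))"
proof -
  have "fp n (\<lambda>vs. spine_fold (\<lambda>x r. (\<lambda>us. Node (left (us ! 1)) (us ! 0)) (r # x # vs)) (G vs) (F vs))"
  proof (rule fp_spine_fold[where q = "[:1, 1:]"])
    fix r x :: tree and vs :: "tree list"
    have "size (left x) \<le> size x" by (cases x) auto
    then show "size (Node (left ((r # x # vs) ! 1)) ((r # x # vs) ! 0))
        \<le> size r + poly [:1, 1:] (size x + total_size vs)"
      by simp
  qed (intro assms fp_node fp_left fp_var; simp)+
  then show ?thesis by (rule fp_cong) (simp add: spine_append_def)
qed

text \<open>The loop body sees the current nonempty suffix of the list, not only its first element.\<close>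

definition spine_concat :: "(tree \<Rightarrow> tree) \<Rightarrow> tree \<Rightarrow> tree" where
  "spine_concat h x = spine_fold (\<lambda>s r. spine_append (h s) r) Leaf x"

lemma spine_concat_simps [simp]:
  "spine_concat h Leaf = Leaf"
  "spine_concat h (Node l r) = spine_append (h (Node l r)) (spine_concat h r)"
  by (simp_all add: spine_concat_def)

lemma fp_spine_concat:
  assumes H: "fp (Suc n) H" and X: "fp n X"
  shows "fp n (\<lambda>vs. spine_concat (\<lambda>s. H (s # vs)) (X vs))"
proof -
  obtain q where q: "\<And>vs. length vs = Suc n \<Longrightarrow> size (H vs) \<le> poly q (total_size vs)"
    using fp_size[OF H] by blast
  \<comment> \<open>Composition with projections drops argument 0, the intermediate result, so that
    \<open>H\<close> sees the current suffix and the parameters only.\<close>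
  have "fp (Suc (Suc n)) (\<lambda>vs. H (map (\<lambda>F. F vs) (map (\<lambda>i vs. vs ! i) [1..<Suc (Suc n)])))"
    by (rule fp_comp[OF H]) (auto intro!: fp_var)
  moreover have "map (\<lambda>F. F vs) (map (\<lambda>i vs. vs ! i) [1..<Suc (Suc n)]) = tl vs"
    if "length vs = Suc (Suc n)" for vs :: "tree list"
    using that by (intro nth_equalityI) (auto simp: nth_tl simp del: upt_Suc)
  ultimately have "fp (Suc (Suc n)) (\<lambda>vs. H (tl vs))"
    by (elim fp_cong) (simp del: upt_Suc map_map)
  then have "fp (Suc (Suc n)) (\<lambda>vs. spine_append (H (tl vs)) (vs ! 0))"
    by (intro fp_spine_append fp_var) auto
  then have "fp n (\<lambda>vs. spine_fold
      (\<lambda>s r. (\<lambda>us. spine_append (H (tl us)) (us ! 0)) (r # s # vs)) Leaf (X vs))"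
    by (rule fp_spine_fold[where q = q])
      (use q[of "_ # _"] in \<open>auto intro: fp_leaf X simp: size_spine_append\<close>)
  then show ?thesis by (rule fp_cong) (simp add: spine_concat_def)
qed

lemma polytime_on_fp:
  assumes "fp 1 (\<lambda>vs. f (vs ! 0))"
  shows "polytime_on A f"
proof -
  \<comment> \<open>Offset 1, since slot 0 is taken by the entry expression
    \<open>e\<close>.\<close>
  obtain P e p where *: "\<And>P0 Q vs. length P0 = 1 \<Longrightarrow> length vs = 1 \<Longrightarrow>
     \<exists>t \<le> poly p (total_size vs). eval (P0 @ P @ Q) vs e (f (vs ! 0)) t"
    by (rule fpE[OF assms]) (rule that, assumption)
  have "\<exists>t \<le> poly ([:2, 1:] + p) (size x). runs_to (e # P) x (f x) t" for x
  proof -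
    obtain t where t: "t \<le> poly p (size x)" "eval (e # P) [x] e (f x) t"
      using *[of "[e]" "[x]" "[]"] by auto
    have "evals (e # P) [x] [EVar 0] [x] (1 + size x)"
      using evals_all_vars[of "e # P" "[x]"] by simp
    then have "runs_to (e # P) x (f x) (1 + (1 + size x) + t)"
      unfolding runs_to_def using t(2) by (intro eval_Call) auto
    with t(1) show ?thesis by (intro exI[of _ "1 + (1 + size x) + t"]) auto
  qed
  then show ?thesis unfolding polytime_on_def by blast
qed

section \<open>Simulations and runs of nets\<close>

lemma lts_union_Inl: "lts_union S T (Inl c) a y \<longleftrightarrow> (\<exists>d. y = Inl d \<and> S c a d)"
  by (cases y) auto

lemma lts_union_Inr: "lts_union S T (Inr c) a y \<longleftrightarrow> (\<exists>d. y = Inr d \<and> T c a d)"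
  by (cases y) auto

lemma rtranclp_lts_step:
  "(\<lambda>c d. T c a d)\<^sup>*\<^sup>* c d \<Longrightarrow> T d a e \<Longrightarrow> (\<lambda>c d. T c a d)\<^sup>*\<^sup>* c e"
  by (rule rtranclp.rtrancl_into_rtrancl)

lemma rtranclp_lts_union_Inr:
  "(\<lambda>c d. lts_union S T c a d)\<^sup>*\<^sup>* (Inr c) y \<longleftrightarrow> (\<exists>d. y = Inr d \<and> (\<lambda>c d. T c a d)\<^sup>*\<^sup>* c d)"
proof
  assume "(\<lambda>c d. lts_union S T c a d)\<^sup>*\<^sup>* (Inr c) y"
  then show "\<exists>d. y = Inr d \<and> (\<lambda>c d. T c a d)\<^sup>*\<^sup>* c d"
  proof induction
    case base
    show ?case by auto
  next
    case (step y z)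
    then obtain d e where "z = Inr e" "(\<lambda>c d. T c a d)\<^sup>*\<^sup>* c d" "T d a e"
      by (auto simp: lts_union_Inr)
    then show ?case using rtranclp_lts_step[of T a c d e] by blast
  qed
next
  assume "\<exists>d. y = Inr d \<and> (\<lambda>c d. T c a d)\<^sup>*\<^sup>* c d"
  then obtain d where y: "y = Inr d" and "(\<lambda>c d. T c a d)\<^sup>*\<^sup>* c d" by blast
  from this(2) show "(\<lambda>c d. lts_union S T c a d)\<^sup>*\<^sup>* (Inr c) y"
    unfolding y
  proof induction
    case (step d e)
    then show ?case using rtranclp_lts_step[of "lts_union S T" a "Inr c" "Inr d" "Inr e"] by simp
  qed simp
qed

lemma weak_step_tau: "weak_step T tau tau c d \<longleftrightarrow> (\<lambda>c d. T c tau d)\<^sup>*\<^sup>* c d"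
  by (simp add: weak_step_def)

lemma weak_step_visible:
  "a \<noteq> tau \<Longrightarrow> weak_step T tau a c d \<longleftrightarrow>
    (\<exists>c1 c2. (\<lambda>c d. T c tau d)\<^sup>*\<^sup>* c c1 \<and> T c1 a c2 \<and> (\<lambda>c d. T c tau d)\<^sup>*\<^sup>* c2 d)"
  by (auto simp: weak_step_def Let_def OO_def)

lemma weak_step_union_Inr:
  "weak_step (lts_union S T) tau a (Inr c) y \<longleftrightarrow> (\<exists>d. y = Inr d \<and> weak_step T tau a c d)"
proof (cases "a = tau")
  case True
  then show ?thesis by (simp add: weak_step_tau rtranclp_lts_union_Inr)
next
  case False
  let ?U = "lts_union S T"
  show ?thesis
  proof
    assume "weak_step ?U tau a (Inr c) y"
    then obtain x1 x2 where x: "(\<lambda>c d. ?U c tau d)\<^sup>*\<^sup>* (Inr c) x1" "?U x1 a x2"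
      "(\<lambda>c d. ?U c tau d)\<^sup>*\<^sup>* x2 y"
      unfolding weak_step_visible[OF False] by blast
    from x(1) obtain c1 where c1: "x1 = Inr c1" "(\<lambda>c d. T c tau d)\<^sup>*\<^sup>* c c1"
      unfolding rtranclp_lts_union_Inr by blast
    from x(2) obtain c2 where c2: "x2 = Inr c2" "T c1 a c2"
      unfolding c1(1) lts_union_Inr by blast
    from x(3) obtain d where "y = Inr d" "(\<lambda>c d. T c tau d)\<^sup>*\<^sup>* c2 d"
      unfolding c2(1) rtranclp_lts_union_Inr by blast
    with c1 c2 show "\<exists>d. y = Inr d \<and> weak_step T tau a c d"
      unfolding weak_step_visible[OF False] by blast
  next
    assume "\<exists>d. y = Inr d \<and> weak_step T tau a c d"
    then obtain d c1 c2 where c: "y = Inr d" "(\<lambda>c d. T c tau d)\<^sup>*\<^sup>* c c1" "T c1 a c2"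
      "(\<lambda>c d. T c tau d)\<^sup>*\<^sup>* c2 d"
      unfolding weak_step_visible[OF False] by blast
    have "(\<lambda>c d. ?U c tau d)\<^sup>*\<^sup>* (Inr c) (Inr c1)" "?U (Inr c1) a (Inr c2)"
      "(\<lambda>c d. ?U c tau d)\<^sup>*\<^sup>* (Inr c2) y"
      using c unfolding rtranclp_lts_union_Inr by auto
    then show "weak_step ?U tau a (Inr c) y"
      unfolding weak_step_visible[OF False] by blast
  qed
qed

abbreviation (input) weak_sim_between where
  "weak_sim_between S T tau c c' \<equiv> weak_sim (lts_union S T) tau (Inl c) (Inr c')"

abbreviation (input) strong_sim_between where
  "strong_sim_between S T c c' \<equiv> strong_sim (lts_union S T) (Inl c) (Inr c')"

lemma weak_sim_between_step:
  assumes "weak_sim_between S T tau c c'" "S c a d"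
  shows "\<exists>d'. weak_step T tau a c' d' \<and> weak_sim_between S T tau d d'"
  using weak_sim_largest(1)[of "lts_union S T" tau] assms
  unfolding is_weak_simulation_def
  by (metis lts_union.simps(1) weak_step_union_Inr)

lemma strong_sim_between_step:
  assumes "strong_sim_between S T c c'" "S c a d"
  shows "\<exists>d'. T c' a d' \<and> strong_sim_between S T d d'"
  using strong_sim_largest(1)[of "lts_union S T"] assms
  unfolding is_strong_simulation_def
  by (metis lts_union.simps(1) lts_union_Inr)

text \<open>It suffices to relate left to right configurations, because no step of the disjoint
  union leaves its side.\<close>

lemma weak_sim_betweenI:
  fixes S :: "('a, 'c) lts" and T :: "('b, 'c) lts"
  assumes "R c c'"
    and "\<And>c c' a d. R c c' \<Longrightarrow> S c a d \<Longrightarrow> \<exists>d'. weak_step T tau a c' d' \<and> R d d'"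
  shows "weak_sim_between S T tau c c'"
proof -
  let ?R = "\<lambda>(x :: 'a + 'b) (y :: 'a + 'b). \<exists>c c'. x = Inl c \<and> y = Inr c' \<and> R c c'"
  have "is_weak_simulation (lts_union S T) tau ?R"
    unfolding is_weak_simulation_def
  proof (intro allI impI)
    fix x y :: "'a + 'b" and a x' assume "?R x y" "lts_union S T x a x'"
    then obtain c c' d where "x' = Inl d" "y = Inr c'" "R c c'" "S c a d"
      by (auto simp: lts_union_Inl)
    with assms(2)[of c c' a d]
    show "\<exists>d'. weak_step (lts_union S T) tau a y d' \<and> ?R x' d'"
      by (auto simp: weak_step_union_Inr)
  qed
  with assms(1) show ?thesis unfolding weak_sim_def by blast
qed

lemma strong_sim_betweenI:
  fixes S :: "('a, 'c) lts" and T :: "('b, 'c) lts"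
  assumes "R c c'"
    and "\<And>c c' a d. R c c' \<Longrightarrow> S c a d \<Longrightarrow> \<exists>d'. T c' a d' \<and> R d d'"
  shows "strong_sim_between S T c c'"
proof -
  let ?R = "\<lambda>(x :: 'a + 'b) (y :: 'a + 'b). \<exists>c c'. x = Inl c \<and> y = Inr c' \<and> R c c'"
  have "is_strong_simulation (lts_union S T) ?R"
    unfolding is_strong_simulation_def
  proof (intro allI impI)
    fix x y :: "'a + 'b" and a x' assume "?R x y" "lts_union S T x a x'"
    then obtain c c' d where "x' = Inl d" "y = Inr c'" "R c c'" "S c a d"
      by (auto simp: lts_union_Inl)
    with assms(2)[of c c' a d]
    show "\<exists>d'. lts_union S T y a d' \<and> ?R x' d'"
      by (auto simp: lts_union_Inr)
  qed
  with assms(1) show ?thesis unfolding strong_sim_def by blast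
qed

lemma relpowp_split:
  assumes "((r :: 'a \<Rightarrow> 'a \<Rightarrow> bool) ^^ k) x y"
  obtains f where "f 0 = x" "f k = y" "\<And>i j. i \<le> j \<Longrightarrow> j \<le> k \<Longrightarrow> (r ^^ (j - i)) (f i) (f j)"
proof -
  obtain f where f: "f 0 = x" "f k = y" "\<forall>i < k. r (f i) (f (Suc i))"
    using assms unfolding relpowp_fun_conv by blast
  have "(r ^^ (j - i)) (f i) (f j)" if "i \<le> j" "j \<le> k" for i j
    unfolding relpowp_fun_conv using f(3) that by (intro exI[of _ "\<lambda>l. f (i + l)"]) auto
  with f that show thesis by blast
qed

lemma ocn_lts_shift: "ocn_lts N (p, m) a (q, n) \<Longrightarrow> ocn_lts N (p, m + k) a (q, n + k)"
  by auto

lemma omega_lts_shift: "omega_lts N (p, m) a (q, n) \<Longrightarrow> omega_lts N (p, m + k) a (q, n + k)"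
  by auto

section \<open>Silent runs: monotonicity and pumping\<close>

definition ocn_reach :: "('q, 'a, int) net \<Rightarrow> 'a \<Rightarrow> 'q \<times> nat \<Rightarrow> 'q \<times> nat \<Rightarrow> bool" where
  "ocn_reach N a = (\<lambda>c d. ocn_lts N c a d)\<^sup>*\<^sup>*"

lemma ocn_reach_refl [simp, intro]: "ocn_reach N a c c"
  by (simp add: ocn_reach_def)

lemma ocn_reach_step: "ocn_reach N a c d \<Longrightarrow> ocn_lts N d a e \<Longrightarrow> ocn_reach N a c e"
  unfolding ocn_reach_def by (rule rtranclp_lts_step)

lemma ocn_reach_trans: "ocn_reach N a c d \<Longrightarrow> ocn_reach N a d e \<Longrightarrow> ocn_reach N a c e"
  unfolding ocn_reach_def by (rule rtranclp_trans)

lemma ocn_reach_induct [consumes 1, case_names refl step]: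
  assumes "ocn_reach N a (p, m) (q, n)" and "P p m"
    and "\<And>q n r x. ocn_reach N a (p, m) (q, n) \<Longrightarrow> ocn_lts N (q, n) a (r, x) \<Longrightarrow> P q n \<Longrightarrow> P r x"
  shows "P q n"
  using assms unfolding ocn_reach_def by (rule rtranclp_induct2)

lemma weak_step_ocn_tau: "weak_step (ocn_lts N) tau tau = ocn_reach N tau"
  by (intro ext) (simp add: weak_step_tau ocn_reach_def)

lemma weak_step_ocn_visible:
  "a \<noteq> tau \<Longrightarrow> weak_step (ocn_lts N) tau a c d \<longleftrightarrow>
    (\<exists>c1 c2. ocn_reach N tau c c1 \<and> ocn_lts N c1 a c2 \<and> ocn_reach N tau c2 d)"
  by (auto simp: weak_step_visible ocn_reach_def)

lemma ocn_reach_shift: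
  assumes "ocn_reach N a (p, m) (q, n)"
  shows "ocn_reach N a (p, m + k) (q, n + k)"
  using assms
proof (induction rule: ocn_reach_induct)
  case refl
  show ?case ..
next
  case (step q n r x)
  then show ?case by (meson ocn_lts_shift ocn_reach_step)
qed

lemma weak_step_ocn_shift:
  assumes "weak_step (ocn_lts N) tau a (p, m) (q, n)"
  shows "weak_step (ocn_lts N) tau a (p, m + k) (q, n + k)"
proof (cases "a = tau")
  case True
  then show ?thesis using assms by (simp add: weak_step_ocn_tau ocn_reach_shift)
next
  case False
  then obtain p1 m1 p2 m2 where "ocn_reach N tau (p, m) (p1, m1)"
    "ocn_lts N (p1, m1) a (p2, m2)" "ocn_reach N tau (p2, m2) (q, n)"
    using assms by (auto simp: weak_step_ocn_visible simp del: ocn_lts.simps)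
  then show ?thesis
    unfolding weak_step_ocn_visible[OF False]
    by (meson ocn_reach_shift ocn_lts_shift)
qed

text \<open>Without zero tests every response can be replayed from a larger counter, shifted by the
  difference. The witness relation closes weak simulation under raising the right counter.\<close>

lemma weak_sim_between_mono:
  assumes "weak_sim_between S (ocn_lts N) tau c (q, m)" "m \<le> m'"
  shows "weak_sim_between S (ocn_lts N) tau c (q, m')"
proof (rule weak_sim_betweenI[where
      R = "\<lambda>c c'. \<exists>m \<le> snd c'. weak_sim_between S (ocn_lts N) tau c (fst c', m)"])
  show "\<exists>m \<le> snd (q, m'). weak_sim_between S (ocn_lts N) tau c (fst (q, m'), m)"
    using assms by auto
  fix c c' a d
  assume "\<exists>m \<le> snd c'. weak_sim_between S (ocn_lts N) tau c (fst c', m)" and step: "S c a d"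
  then obtain p n m where c': "c' = (p, n)" "m \<le> n" "weak_sim_between S (ocn_lts N) tau c (p, m)"
    by (cases c') auto
  with weak_sim_between_step[OF c'(3) step] obtain r x where
    "weak_step (ocn_lts N) tau a (p, m) (r, x)" "weak_sim_between S (ocn_lts N) tau d (r, x)"
    by auto
  then show "\<exists>d'. weak_step (ocn_lts N) tau a c' d' \<and>
      (\<exists>m \<le> snd d'. weak_sim_between S (ocn_lts N) tau d (fst d', m))"
    using c' weak_step_ocn_shift[of N tau a p m r x "n - m"]
    by (intro exI[of _ "(r, x + (n - m))"] conjI exI[of _ x]) auto
qed

text \<open>An omega step only requires the counter to grow, so it too survives adding a constant at
  both ends.\<close>

lemma strong_sim_between_mono:
  assumes "strong_sim_between S (omega_lts N) c (q, m)" "m \<le> m'"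
  shows "strong_sim_between S (omega_lts N) c (q, m')"
proof (rule strong_sim_betweenI[where
      R = "\<lambda>c c'. \<exists>m \<le> snd c'. strong_sim_between S (omega_lts N) c (fst c', m)"])
  show "\<exists>m \<le> snd (q, m'). strong_sim_between S (omega_lts N) c (fst (q, m'), m)"
    using assms by auto
  fix c c' a d
  assume "\<exists>m \<le> snd c'. strong_sim_between S (omega_lts N) c (fst c', m)" and step: "S c a d"
  then obtain p n m where c': "c' = (p, n)" "m \<le> n" "strong_sim_between S (omega_lts N) c (p, m)"
    by (cases c') auto
  with strong_sim_between_step[OF c'(3) step] obtain r x where
    "omega_lts N (p, m) a (r, x)" "strong_sim_between S (omega_lts N) d (r, x)"
    by auto
  then show "\<exists>d'. omega_lts N c' a d' \<and>
      (\<exists>m \<le> snd d'. strong_sim_between S (omega_lts N) d (fst d', m))"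
    using c' omega_lts_shift[of N p m a r x "n - m"]
    by (intro exI[of _ "(r, x + (n - m))"] conjI exI[of _ x]) (auto simp del: omega_lts.simps)
qed

lemma ocn_states:
  assumes "is_ocn N" "(p, a, d, q) \<in> delta N"
  shows "p \<in> states N" "q \<in> states N" "a \<in> acts N" "d \<in> {-1, 0, 1}"
  using assms unfolding is_ocn_def by auto

lemma ocn_reach_states:
  "is_ocn N \<Longrightarrow> ocn_reach N a (p, m) (q, n) \<Longrightarrow> p \<in> states N \<Longrightarrow> q \<in> states N"
  by (erule ocn_reach_induct) (auto dest: ocn_states)

text \<open>A discrete intermediate value property: a step raises the counter by at most
  one.\<close>

lemma ocn_reach_level:
  assumes N: "is_ocn N" and "ocn_reach N a (p, m) (q, n)" "m < n"
  shows "\<exists>s. ocn_reach N a (p, m) (s, Suc m) \<and> ocn_reach N a (s, Suc m) (q, n)"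
  using assms(2,3)
proof (induction rule: ocn_reach_induct)
  case refl
  then show ?case by simp
next
  case (step q n r x)
  from step(2) N have "x = Suc n \<or> x \<le> n"
    by (auto dest: ocn_states(4))
  with step.prems consider "m < n" | "x = Suc m" by linarith
  then show ?case
  proof cases
    case 1
    with step show ?thesis by (meson ocn_reach_step)
  next
    case 2
    with step show ?thesis by (meson ocn_reach_step ocn_reach_refl)
  qed
qed

lemma ocn_reach_pump:
  assumes "ocn_reach N a (s, l) (s, l + k)"
  shows "ocn_reach N a (s, l) (s, l + j * k)"
proof (induction j)
  case (Suc j)
  have "ocn_reach N a (s, l + j * k) (s, l + k + j * k)"
    using ocn_reach_shift[OF assms, of "j * k"] by simp
  with Suc show ?case by (auto simp: algebra_simps dest: ocn_reach_trans)
qed simp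

text \<open>On a run that climbs through more levels than there are states, some state occurs on two
  levels, so the run contains a cycle with positive effect.\<close>

lemma ocn_reach_unbounded:
  assumes N: "is_ocn N" and reach: "ocn_reach N a (r, y) (p, x)"
    and r: "r \<in> states N" and climb: "y + card (states N) \<le> x"
  shows "\<exists>x' \<ge> B. ocn_reach N a (r, y) (p, x')"
proof -
  let ?n = "card (states N)"
  define lev where "lev s i \<longleftrightarrow> ocn_reach N a (r, y) (s, y + i) \<and> ocn_reach N a (s, y + i) (p, x)"
    for s i
  \<comment> \<open>Each new level is picked on a run that starts at the previous pick. Thus the
    picked configurations are connected with each other, and equal states at two levels really form
    a cycle.\<close>
  have "\<exists>f. f 0 = r \<and> (\<forall>i \<le> j. lev (f i) i) \<and>
      (\<forall>i < j. ocn_reach N a (f i, y + i) (f (Suc i), y + Suc i))" if "j \<le> ?n" for j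
    using that
  proof (induction j)
    case 0
    show ?case by (rule exI[of _ "\<lambda>_. r"]) (auto simp: lev_def reach)
  next
    case (Suc j)
    then obtain f where f: "f 0 = r" "\<forall>i \<le> j. lev (f i) i"
      "\<forall>i < j. ocn_reach N a (f i, y + i) (f (Suc i), y + Suc i)" by auto
    then have "ocn_reach N a (f j, y + j) (p, x)" by (auto simp: lev_def)
    moreover have "y + j < x" using Suc.prems climb by simp
    ultimately obtain s where s: "ocn_reach N a (f j, y + j) (s, y + Suc j)"
      "ocn_reach N a (s, y + Suc j) (p, x)"
      using ocn_reach_level[OF N] by fastforce
    then have "lev s (Suc j)"
      using f(2) by (auto simp: lev_def intro: ocn_reach_trans)
    then show ?case
      using f s by (intro exI[of _ "f(Suc j := s)"]) (auto simp: le_Suc_eq less_Suc_eq)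
  qed
  then obtain f where f: "\<And>i. i \<le> ?n \<Longrightarrow> lev (f i) i"
    and "\<And>i. i < ?n \<Longrightarrow> ocn_reach N a (f i, y + i) (f (Suc i), y + Suc i)"
    by blast
  then have chain: "i \<le> j \<Longrightarrow> j \<le> ?n \<Longrightarrow> ocn_reach N a (f i, y + i) (f j, y + j)" for i j
    by (induction j) (auto simp: le_Suc_eq intro: ocn_reach_trans)
  have fin: "finite (states N)" using N by (simp add: is_ocn_def)
  have "f ` {..?n} \<subseteq> states N"
    using f ocn_reach_states[OF N _ r] unfolding lev_def by blast
  \<comment> \<open>Levels 0 to \<open>?n\<close> are \<open>?n + 1\<close> many, one more than
    there are states.\<close>
  then have "\<not> inj_on f {..?n}"
    using card_inj_on_le[of f "{..?n}" "states N"] fin by auto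
  then obtain i j where ij: "i < j" "j \<le> ?n" "f i = f j"
    unfolding inj_on_def by (metis atMost_iff linorder_neqE_nat)
  define k where "k = j - i"
  have "ocn_reach N a (f i, y + i) (f i, y + i + k)"
    using chain[of i j] ij by (simp add: k_def)
  then have "ocn_reach N a (f i, y + i) (f i, y + i + B * k)"
    by (rule ocn_reach_pump)
  moreover have "ocn_reach N a (r, y) (f i, y + i)" "ocn_reach N a (f i, y + i) (p, x)"
    using f[of i] ij by (auto simp: lev_def)
  \<comment> \<open>The cycle is taken \<open>B\<close> times and the rest of the run is shifted up
    by \<open>B * k\<close>; since \<open>k\<close> is positive, the end is at least
    \<open>B\<close>.\<close>
  ultimately have pumped: "ocn_reach N a (r, y) (p, x + B * k)"
    by (meson ocn_reach_shift ocn_reach_trans)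
  have "B * 1 \<le> B * k" using ij by (intro mult_left_mono) (auto simp: k_def)
  then have "B \<le> x + B * k" unfolding mult_1_right by (rule trans_le_add2)
  with pumped show ?thesis by blast
qed

section \<open>From weak to strong simulation\<close>

primrec spine :: "tree \<Rightarrow> nat" where
  "spine Leaf = 0"
| "spine (Node l r) = Suc (spine r)"

primrec suffixes :: "tree \<Rightarrow> tree list" where
  "suffixes Leaf = [Leaf]"
| "suffixes (Node l r) = Node l r # suffixes r"

lemma spine_right: "spine (right s) = spine s - 1"
  by (cases s) auto

lemma spine_0_iff [simp]: "spine s = 0 \<longleftrightarrow> s = Leaf"
  by (cases s) auto

lemma self_in_suffixes: "s \<in> set (suffixes s)"
  by (cases s) auto

lemma Leaf_in_suffixes: "Leaf \<in> set (suffixes s)"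
  by (induction s) auto

lemma right_in_suffixes: "s \<in> set (suffixes t) \<Longrightarrow> right s \<in> set (suffixes t)"
  by (induction t) (auto simp: self_in_suffixes)

text \<open>The numeral for \<open>i\<close> relative to \<open>t\<close>: the suffix of length
  \<open>i\<close>, if \<open>i\<close> is at most \<open>spine t\<close>.\<close>

definition suffix_at :: "tree \<Rightarrow> nat \<Rightarrow> tree" where
  "suffix_at t i = (right ^^ (spine t - i)) t"

lemma suffix_at_in: "suffix_at t i \<in> set (suffixes t)"
proof -
  have "(right ^^ n) t \<in> set (suffixes t)" for n
    by (induction n) (auto simp: self_in_suffixes right_in_suffixes)
  then show ?thesis by (simp add: suffix_at_def)
qed

lemma spine_suffix_at: "i \<le> spine t \<Longrightarrow> spine (suffix_at t i) = i"
proof -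
  have "spine ((right ^^ n) t) = spine t - n" for n
    by (induction n) (auto simp: spine_right)
  then show "i \<le> spine t \<Longrightarrow> ?thesis" by (simp add: suffix_at_def)
qed

lemma suffix_at_0 [simp]: "suffix_at t 0 = Leaf"
  using spine_suffix_at[of 0 t] by simp

lemma suffix_at_spine [simp]: "suffix_at t (spine t) = t"
  by (simp add: suffix_at_def)

lemma right_suffix_at: "i < spine t \<Longrightarrow> right (suffix_at t (Suc i)) = suffix_at t i"
  by (simp add: suffix_at_def Suc_diff_Suc flip: funpow.simps(2)[unfolded comp_def, THEN fun_cong])

text \<open>Actions: \<open>Leaf\<close> labels the auxiliary steps of a round, \<open>end_round\<close> its last step. They may
  coincide with actions of the given nets. New control states carry \<open>Z\<close>, which is larger than
  all given control states.\<close>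

definition end_round :: tree where
  "end_round = Node Leaf Leaf"

text \<open>Spoiler has already moved to \<open>q\<close> and still owes \<open>spine s\<close>
  auxiliary steps before the end-of-round step.\<close>

definition chain :: "tree \<Rightarrow> tree \<Rightarrow> tree \<Rightarrow> tree" where
  "chain Z q s = Node Z (Node q s)"

definition phase :: "tree \<Rightarrow> tree \<Rightarrow> tree \<Rightarrow> tree \<Rightarrow> tree" where
  "phase Z b p e = Node Z (Node b (Node p e))"

lemma chain_inject [simp]: "chain Z q s = chain Z q' s' \<longleftrightarrow> q = q' \<and> s = s'"
  by (simp add: chain_def)

lemma phase_inject [simp]: "phase Z b p e = phase Z b' p' e' \<longleftrightarrow> b = b' \<and> p = p' \<and> e = e'"
  by (auto simp: phase_def)

text \<open>A silent edge of effect \<open>d\<close> is indexed by the larger of its two heights,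
  because a suffix can be shortened but not extended. As \<open>right Leaf = Leaf\<close>, a
  decrement at height 0 stays there: the running minimum drops together with the counter.\<close>

definition height_before :: "int \<Rightarrow> tree \<Rightarrow> tree" where
  "height_before d s = (if d = 1 then right s else s)"

definition height_after :: "int \<Rightarrow> tree \<Rightarrow> tree" where
  "height_after d s = (if d = -1 then right s else s)"

text \<open>Height 0 may be kept under any effect, also under an increment, since the stored height
  is only a lower bound. This gives untracked silent steps for use after an omega step.\<close>

lemma height_Leaf: "height_before d Leaf = Leaf" "height_after d Leaf = Leaf"
  by (simp_all add: height_before_def height_after_def)

text \<open>All choices of a round, including the counter effect, are made by its first step. Once
  the chain states are fresh, the rest of the round is deterministic and leaves the counter
  alone.\<close>

definition spoiler_net :: "tree \<Rightarrow> tree \<Rightarrow> (tree, tree, int) net \<Rightarrow> (tree, tree, int) net" where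
  "spoiler_net Z K N =
     \<lparr>states = states N \<union> {chain Z q s | q s. q \<in> states N \<and> s \<in> set (suffixes K)},
      acts = {Leaf, end_round} \<union> acts N,
      delta = {(p, a, d, chain Z q K) | p a d q. (p, a, d, q) \<in> delta N} \<union>
        {(chain Z q s, Leaf, 0, chain Z q (right s)) | q s.
           q \<in> states N \<and> s \<in> set (suffixes K) \<and> s \<noteq> Leaf} \<union>
        {(chain Z q Leaf, end_round, 0, q) | q. q \<in> states N}\<rparr>"

text \<open>In \<open>phase Z b p e\<close> the response to action \<open>b\<close> is being built, \<open>b = tau\<close> meaning that only silent
  steps are left; the spine length of \<open>e\<close> is a lower bound for the height of the counter above its
  minimum since the last visible step. Height \<open>spine F\<close> permits an \<open>Omega\<close> step.\<close>

definition duplicator_net ::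
  "tree \<Rightarrow> tree \<Rightarrow> tree \<Rightarrow> (tree, tree, int) net \<Rightarrow> (tree, tree, effect) net" where
  "duplicator_net tau Z F N =
     \<lparr>states = states N \<union>
        {phase Z b p s | b p s. b \<in> acts N \<and> p \<in> states N \<and> s \<in> set (suffixes F)},
      acts = {Leaf, end_round} \<union> acts N,
      delta = {(phase Z a p s, Leaf, Fin d, phase Z tau q Leaf) | p a d q s.
           (p, a, d, q) \<in> delta N \<and> s \<in> set (suffixes F)} \<union>
        {(phase Z b p (height_before d s), Leaf, Fin d, phase Z b q (height_after d s)) | p d q b s.
           (p, tau, d, q) \<in> delta N \<and> b \<in> acts N \<and> s \<in> set (suffixes F)} \<union>
        {(phase Z b p s, Leaf, Fin 0, phase Z b p Leaf) | b p s.
           b \<in> acts N \<and> p \<in> states N \<and> s \<in> set (suffixes F)} \<union>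
        {(phase Z b p F, Leaf, Omega, phase Z b p Leaf) | b p. b \<in> acts N \<and> p \<in> states N} \<union>
        {(phase Z tau p s, end_round, Fin 0, p) | p s. p \<in> states N \<and> s \<in> set (suffixes F)} \<union>
        {(p, b, Fin 0, phase Z b p Leaf) | b p. b \<in> acts N \<and> p \<in> states N}\<rparr>"

lemma finite_pairs: "finite A \<Longrightarrow> finite B \<Longrightarrow> finite {f x y | x y. x \<in> A \<and> y \<in> B}"
  by (rule finite_subset[of _ "(\<lambda>(x, y). f x y) ` (A \<times> B)"]) auto

lemma finite_triples:
  "finite A \<Longrightarrow> finite B \<Longrightarrow> finite C \<Longrightarrow> finite {f x y z | x y z. x \<in> A \<and> y \<in> B \<and> z \<in> C}"
  by (rule finite_subset[of _ "(\<lambda>(x, y, z). f x y z) ` (A \<times> B \<times> C)"]) force+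

lemma is_ocn_spoiler_net: "is_ocn N \<Longrightarrow> is_ocn (spoiler_net Z K N)"
  unfolding is_ocn_def spoiler_net_def
  by (auto intro!: finite_pairs simp: self_in_suffixes Leaf_in_suffixes right_in_suffixes)

lemma is_omega_net_duplicator_net:
  assumes "is_ocn N" "tau \<in> acts N"
  shows "is_omega_net (duplicator_net tau Z F N)"
proof -
  have "finite (states N)" "finite (acts N)"
    and *: "\<And>p a d q. (p, a, d, q) \<in> delta N \<Longrightarrow>
      p \<in> states N \<and> a \<in> acts N \<and> (d = -1 \<or> d = 0 \<or> d = 1) \<and> q \<in> states N"
    using assms by (auto simp: is_ocn_def)
  with assms(2) show ?thesis
    unfolding is_omega_net_def duplicator_net_def
    by (auto intro!: finite_triples dest!: *
        simp: self_in_suffixes Leaf_in_suffixes right_in_suffixes height_before_def height_after_def)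
qed

text \<open>\<open>K_long\<close> pays for two silent stretches, before and after one visible step.
  It is demanded only if the second net has states, since otherwise the computed \<open>K\<close> is
  \<open>Leaf\<close>. By \<open>fresh\<close>, a new state cannot be an old one, as it properly
  contains \<open>Z\<close>.\<close>

locale weak_elimination =
  fixes N N' :: "(tree, tree, int) net" and tau Z F K :: tree
  assumes N: "is_ocn N" and N': "is_ocn N'" and tau: "tau \<in> acts N'"
    and fresh: "\<And>q. q \<in> states N \<union> states N' \<Longrightarrow> size q \<le> size Z"
    and F_long: "card (states N') \<le> spine F"
    and K_long: "states N' \<noteq> {} \<Longrightarrow>
      2 * (card (states N') * spine F + card (delta N') + 2) + 1 \<le> spine K"
begin

abbreviation "M \<equiv> spoiler_net Z K N"
abbreviation "M' \<equiv> duplicator_net tau Z F N'"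
abbreviation "aux_step \<equiv> \<lambda>c d. omega_lts M' c Leaf d"

lemma chain_fresh [simp]: "q \<in> states N \<Longrightarrow> chain Z p s \<noteq> q" "q \<in> states N \<Longrightarrow> q \<noteq> chain Z p s"
  "chain Z p s \<notin> states N"
  using fresh[of q] fresh[of "chain Z p s"] by (auto simp: chain_def)

lemma phase_fresh [simp]: "q \<in> states N' \<Longrightarrow> phase Z b p s \<noteq> q" "q \<in> states N' \<Longrightarrow> q \<noteq> phase Z b p s"
  "phase Z b p s \<notin> states N'"
  using fresh[of q] fresh[of "phase Z b p s"] by (auto simp: phase_def)

lemma delta_fresh [simp]: "(chain Z p s, a, d, q) \<notin> delta N" "(phase Z b p' s, a, d, q) \<notin> delta N'"
  using ocn_states(1)[OF N] ocn_states(1)[OF N'] by (metis chain_fresh(1), metis phase_fresh(1))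

lemma M_state_step:
  "q \<in> states N \<Longrightarrow> ocn_lts M (q, n) a y \<longleftrightarrow>
    (\<exists>q2 n2. y = (chain Z q2 K, n2) \<and> ocn_lts N (q, n) a (q2, n2))"
  by (cases y) (auto simp: spoiler_net_def)

lemma M_chain_step:
  "ocn_lts M (chain Z q s, n) a y \<longleftrightarrow> q \<in> states N \<and> s \<in> set (suffixes K) \<and>
    (if s = Leaf then a = end_round \<and> y = (q, n) else a = Leaf \<and> y = (chain Z q (right s), n))"
  by (cases y) (auto simp: spoiler_net_def Leaf_in_suffixes)

lemma M'_state_step:
  "p \<in> states N' \<Longrightarrow> omega_lts M' (p, n) a y \<longleftrightarrow> a \<in> acts N' \<and> y = (phase Z a p Leaf, n)"
  by (cases y) (auto simp: duplicator_net_def)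

lemma M'_end_round_step:
  "omega_lts M' (phase Z b p e, n) end_round y \<longleftrightarrow>
    b = tau \<and> p \<in> states N' \<and> e \<in> set (suffixes F) \<and> y = (p, n)"
  by (cases y) (auto simp: duplicator_net_def end_round_def)

lemma aux_step_cases:
  assumes "aux_step (phase Z b p e, n) y"
  obtains
    (visible) d q n' where "(p, b, d, q) \<in> delta N'" "int n' = int n + d"
      "y = (phase Z tau q Leaf, n')"
  | (silent) d q s n' where "(p, tau, d, q) \<in> delta N'" "int n' = int n + d"
      "e = height_before d s" "y = (phase Z b q (height_after d s), n')"
  | (reset) "p \<in> states N'" "y = (phase Z b p Leaf, n)"
  | (omega) n' where "p \<in> states N'" "e = F" "y = (phase Z b p Leaf, n')"
  using assms by (cases y) (auto simp: duplicator_net_def end_round_def)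

lemma aux_step_visible:
  "(p, b, d, q) \<in> delta N' \<Longrightarrow> int n' = int n + d \<Longrightarrow>
    aux_step (phase Z b p Leaf, n) (phase Z tau q Leaf, n')"
  using Leaf_in_suffixes by (auto simp: duplicator_net_def)

lemma aux_step_silent:
  "(p, tau, d, q) \<in> delta N' \<Longrightarrow> int n' = int n + d \<Longrightarrow> b \<in> acts N' \<Longrightarrow> s \<in> set (suffixes F) \<Longrightarrow>
    aux_step (phase Z b p (height_before d s), n) (phase Z b q (height_after d s), n')"
  by (auto simp: duplicator_net_def)

lemma aux_step_reset:
  "p \<in> states N' \<Longrightarrow> b \<in> acts N' \<Longrightarrow> s \<in> set (suffixes F) \<Longrightarrow>
    aux_step (phase Z b p s, n) (phase Z b p Leaf, n)"
  by (auto simp: duplicator_net_def)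

lemma aux_step_omega:
  "p \<in> states N' \<Longrightarrow> b \<in> acts N' \<Longrightarrow> n < n' \<Longrightarrow>
    aux_step (phase Z b p F, n) (phase Z b p Leaf, n')"
  by (auto simp: duplicator_net_def)

section \<open>Soundness: auxiliary play is dominated by a weak step\<close>

abbreviation "reach \<equiv> ocn_reach N' tau"

text \<open>What a stored height proves: a genuine silent run from \<open>c\<close> to
  \<open>p\<close> has a low point \<open>(r, y)\<close> and ends at least \<open>spine e\<close>
  above it. Its final counter need only dominate the counter \<open>n\<close> of the game. For
  \<open>e = F\<close> the part after the low point can be pumped.\<close>

definition covered :: "tree \<times> nat \<Rightarrow> tree \<Rightarrow> nat \<Rightarrow> tree \<Rightarrow> bool" where
  "covered c p n e \<longleftrightarrow> (\<exists>r y x. r \<in> states N' \<and> reach c (r, y) \<and> reach (r, y) (p, x) \<and>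
     y + spine e \<le> x \<and> n \<le> x)"

lemma covered_trans: "reach c c' \<Longrightarrow> covered c' p n e \<Longrightarrow> covered c p n e"
  unfolding covered_def by (meson ocn_reach_trans)

lemma covered_reach: "covered c p n e \<Longrightarrow> \<exists>x \<ge> n. reach c (p, x)"
  unfolding covered_def by (meson ocn_reach_trans)

lemma covered_LeafI: "p \<in> states N' \<Longrightarrow> reach c (p, x) \<Longrightarrow> n \<le> x \<Longrightarrow> covered c p n Leaf"
  unfolding covered_def by (intro exI[of _ p] exI[of _ x]) auto

lemma covered_visible:
  assumes "covered c p n e" "(p, a, d, q) \<in> delta N'" "int n' = int n + d"
  shows "\<exists>c1 c2. reach c c1 \<and> ocn_lts N' c1 a c2 \<and> covered c2 q n' Leaf"
proof -
  obtain x where x: "n \<le> x" "reach c (p, x)" using covered_reach[OF assms(1)] by blast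
  then have "ocn_lts N' (p, x) a (q, nat (int x + d))"
    using assms(2,3) by auto
  moreover have "covered (q, nat (int x + d)) q n' Leaf"
    by (rule covered_LeafI[where x = "nat (int x + d)"])
      (use ocn_states(2)[OF N' assms(2)] x assms(3) in auto)
  ultimately show ?thesis using x by blast
qed

lemma covered_silent:
  assumes "covered c p n (height_before d s)" "(p, tau, d, q) \<in> delta N'" "int n' = int n + d"
  shows "covered c q n' (height_after d s)"
proof -
  obtain r y x where x: "r \<in> states N'" "reach c (r, y)" "reach (r, y) (p, x)"
    "y + spine (height_before d s) \<le> x" "n \<le> x"
    using assms(1) by (auto simp: covered_def)
  define x' where "x' = nat (int x + d)"
  have x': "int x' = int x + d" "n' \<le> x'" using assms(3) x(5) by (auto simp: x'_def)
  then have step: "ocn_lts N' (p, x) tau (q, x')" using assms(2) by auto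
  have d: "d = -1 \<or> d = 0 \<or> d = 1" using ocn_states(4)[OF N' assms(2)] by simp
  show ?thesis
  \<comment> \<open>At height 0 the counter may have fallen below the old low point, so the current
    configuration becomes the new one. Otherwise the stored height changes by exactly
    \<open>d\<close>, as the counter does, and the old low point remains valid.\<close>
  proof (cases "height_after d s = Leaf")
    case True
    then show ?thesis
      using covered_LeafI[of q c x' n'] x step x' ocn_states(2)[OF N' assms(2)]
      by (metis ocn_reach_step ocn_reach_trans)
  next
    case False
    then have "y + spine (height_after d s) \<le> x'"
      using x(4) x'(1) d by (cases s) (auto simp: height_before_def height_after_def spine_right)
    then show ?thesis
      unfolding covered_def using x step x'(2) by (meson ocn_reach_step)
  qed
qed

text \<open>Pumping between low point and current configuration exceeds whatever value the omega
  step chose; \<open>F_long\<close> supplies the required climb.\<close>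

lemma covered_omega:
  assumes "covered c p n F" "p \<in> states N'"
  shows "covered c p n' Leaf"
proof -
  obtain r y x where "r \<in> states N'" "reach c (r, y)" "reach (r, y) (p, x)" "y + spine F \<le> x"
    using assms(1) by (auto simp: covered_def)
  with ocn_reach_unbounded[OF N', of tau r y p x n'] F_long obtain x' where
    "n' \<le> x'" "reach (r, y) (p, x')" by auto
  with \<open>reach c (r, y)\<close> show ?thesis
    by (intro covered_LeafI[OF assms(2), of c x']) (rule ocn_reach_trans)
qed

text \<open>Invariant of a round that started in \<open>c\<close> with action \<open>a\<close>:
  either \<open>a\<close> is still pending, or it has been performed between \<open>c1\<close> and
  \<open>c2\<close> and heights are measured from \<open>c2\<close> on. For \<open>a = tau\<close>
  both cases may apply.\<close>

definition sound :: "tree \<Rightarrow> tree \<times> nat \<Rightarrow> tree \<times> nat \<Rightarrow> bool" where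
  "sound a c y \<longleftrightarrow> (\<exists>b p e n. y = (phase Z b p e, n) \<and>
     (b = a \<and> covered c p n e \<or>
      b = tau \<and> (\<exists>c1 c2. reach c c1 \<and> ocn_lts N' c1 a c2 \<and> covered c2 p n e)))"

lemma soundI:
  "covered c p n e \<Longrightarrow> sound a c (phase Z a p e, n)"
  "reach c c1 \<Longrightarrow> ocn_lts N' c1 a c2 \<Longrightarrow> covered c2 p n e \<Longrightarrow> sound a c (phase Z tau p e, n)"
  unfolding sound_def by blast+

lemma sound_step:
  assumes "sound a c y" "aux_step y y'"
  shows "sound a c y'"
proof -
  obtain b p e n where y: "y = (phase Z b p e, n)"
    and inv: "b = a \<and> covered c p n e \<or>
      b = tau \<and> (\<exists>c1 c2. reach c c1 \<and> ocn_lts N' c1 a c2 \<and> covered c2 p n e)"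
    using assms(1) unfolding sound_def by blast
  from assms(2)[unfolded y] show ?thesis
  proof (cases rule: aux_step_cases)
    case (visible d q n')
    from inv show ?thesis
    proof (elim disjE conjE exE)
      assume "b = a" "covered c p n e"
      then show ?thesis
        using covered_visible[of c p n e a d q n'] visible soundI(2) by blast
    next
      \<comment> \<open>In phase \<open>tau\<close> the edges meant for the announced action carry
        \<open>tau\<close> transitions and are absorbed as further silent steps.\<close>
      fix c1 c2
      assume *: "b = tau" "reach c c1" "ocn_lts N' c1 a c2" "covered c2 p n e"
      then obtain c3 c4 where "reach c2 c3" "ocn_lts N' c3 tau c4" "covered c4 q n' Leaf"
        using covered_visible[of c2 p n e tau d q n'] visible by blast
      then have "covered c2 q n' Leaf"
        by (meson covered_trans ocn_reach_step)
      then show ?thesis using * visible soundI(2) by blast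
    qed
  next
    case (silent d q s n')
    then show ?thesis
      using inv covered_silent[of _ p n d s q n'] soundI by blast
  next
    case reset
    then have "covered c' p n Leaf" if "covered c' p n e" for c'
      using that covered_reach covered_LeafI by blast
    then show ?thesis using inv reset soundI by blast
  next
    case (omega n')
    then have "covered c' p n' Leaf" if "covered c' p n e" for c'
      using that covered_omega by blast
    then show ?thesis using inv omega soundI by blast
  qed
qed

lemma sound_relpowp: "(aux_step ^^ k) y y' \<Longrightarrow> sound a c y \<Longrightarrow> sound a c y'"
  by (induction k arbitrary: y') (auto elim: relpowp_Suc_E dest: sound_step)

lemma sound_weak_step:
  assumes "sound a c (phase Z tau p e, n)"
  shows "\<exists>x \<ge> n. weak_step (ocn_lts N') tau a c (p, x)"
proof (cases "a = tau")
  case True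
  then have "covered c p n e \<or> (\<exists>c1 c2. reach c c1 \<and> ocn_lts N' c1 tau c2 \<and> covered c2 p n e)"
    using assms unfolding sound_def phase_inject prod.inject by blast
  then have "covered c p n e"
    by (meson covered_trans ocn_reach_step)
  then have "\<exists>x \<ge> n. reach c (p, x)" by (rule covered_reach)
  then show ?thesis using True by (simp add: weak_step_ocn_tau)
next
  case False
  then obtain c1 c2 where "reach c c1" "ocn_lts N' c1 a c2" "covered c2 p n e"
    using assms unfolding sound_def phase_inject prod.inject by blast
  then show ?thesis
    unfolding weak_step_ocn_visible[OF False] using covered_reach by blast
qed

text \<open>Every link of the chain is a \<open>Leaf\<close> step that Duplicator has to answer by
  one auxiliary step; the chain acts as a clock.\<close>

lemma strong_sim_chain:
  assumes "s \<in> set (suffixes K)" "q \<in> states N"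
    and "strong_sim_between (ocn_lts M) (omega_lts M') (chain Z q s, n) y"
  shows "\<exists>y'. (aux_step ^^ spine s) y y' \<and>
    strong_sim_between (ocn_lts M) (omega_lts M') (chain Z q Leaf, n) y'"
  using assms
proof (induction s arbitrary: y)
  case Leaf
  then show ?case by auto
next
  case (Node l r)
  have "ocn_lts M (chain Z q (Node l r), n) Leaf (chain Z q r, n)"
    using Node.prems by (simp add: M_chain_step del: ocn_lts.simps)
  then obtain y1 where "aux_step y y1"
    "strong_sim_between (ocn_lts M) (omega_lts M') (chain Z q r, n) y1"
    using strong_sim_between_step[OF Node.prems(3)] by blast
  moreover have "r \<in> set (suffixes K)"
    using right_in_suffixes[OF Node.prems(1)] by simp
  ultimately show ?case
    using Node.IH(2) Node.prems(2) by (metis relpowp_Suc_I2 spine.simps(2))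
qed

lemma weak_sim_if_strong_sim:
  assumes "q \<in> states N" "q' \<in> states N'"
    and "strong_sim_between (ocn_lts M) (omega_lts M') (q, n) (q', n')"
  shows "weak_sim_between (ocn_lts N) (ocn_lts N') tau (q, n) (q', n')"
proof (rule weak_sim_betweenI[where R = "\<lambda>c c'. fst c \<in> states N \<and> fst c' \<in> states N' \<and>
      strong_sim_between (ocn_lts M) (omega_lts M') c c'"])
  show "fst (q, n) \<in> states N \<and> fst (q', n') \<in> states N' \<and>
      strong_sim_between (ocn_lts M) (omega_lts M') (q, n) (q', n')"
    using assms by simp
  fix c c' a d
  assume "fst c \<in> states N \<and> fst c' \<in> states N' \<and>
    strong_sim_between (ocn_lts M) (omega_lts M') c c'" and step: "ocn_lts N c a d"
  moreover obtain q n q' n' q2 n2 where c: "c = (q, n)" "c' = (q', n')" "d = (q2, n2)"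
    by (metis surj_pair)
  ultimately have q: "q \<in> states N" "q' \<in> states N'"
    and sim: "strong_sim_between (ocn_lts M) (omega_lts M') (q, n) (q', n')" by auto
  have q2: "q2 \<in> states N" using step ocn_states(2)[OF N] c by auto
  have "ocn_lts M (q, n) a (chain Z q2 K, n2)"
    using step unfolding c M_state_step[OF q(1)] by blast
  from strong_sim_between_step[OF sim this] obtain y0 where y0: "omega_lts M' (q', n') a y0"
    "strong_sim_between (ocn_lts M) (omega_lts M') (chain Z q2 K, n2) y0" by blast
  from y0(1) have "y0 = (phase Z a q' Leaf, n')"
    unfolding M'_state_step[OF q(2)] by (rule conjunct2)
  with strong_sim_chain[OF self_in_suffixes q2 y0(2)] obtain y where
    y: "(aux_step ^^ spine K) (phase Z a q' Leaf, n') y"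
      "strong_sim_between (ocn_lts M) (omega_lts M') (chain Z q2 Leaf, n2) y" by blast
  have "ocn_lts M (chain Z q2 Leaf, n2) end_round (q2, n2)"
    using q2 by (simp add: M_chain_step Leaf_in_suffixes del: ocn_lts.simps)
  from strong_sim_between_step[OF y(2) this] obtain w where w: "omega_lts M' y end_round w"
    "strong_sim_between (ocn_lts M) (omega_lts M') (q2, n2) w" by blast
  have "sound a (q', n') (phase Z a q' Leaf, n')"
    using q(2) by (intro soundI(1) covered_LeafI) auto
  then have sound: "sound a (q', n') y" by (rule sound_relpowp[OF y(1)])
  then obtain b p e m where "y = (phase Z b p e, m)"
    unfolding sound_def by blast
  \<comment> \<open>Only phase \<open>tau\<close> can answer \<open>end_round\<close>, so Duplicator
    cannot skip the announced action.\<close>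
  with w(1) have pm: "y = (phase Z tau p e, m)" "w = (p, m)" "p \<in> states N'"
    by (simp_all add: M'_end_round_step del: omega_lts.simps)
  with sound_weak_step[of a "(q', n')" p e m] sound obtain x where
    "m \<le> x" "weak_step (ocn_lts N') tau a (q', n') (p, x)" by blast
  \<comment> \<open>The weak step ends at \<open>x\<close>, the game at \<open>m <= x\<close>;
    monotonicity of strong simulation closes the gap.\<close>
  then show "\<exists>d'. weak_step (ocn_lts N') tau a c' d' \<and> fst d \<in> states N \<and> fst d' \<in> states N' \<and>
      strong_sim_between (ocn_lts M) (omega_lts M') d d'"
    unfolding c using w(2)[unfolded pm(2)] pm(3) q2
    by (intro exI[of _ "(p, x)"] conjI) (simp_all add: strong_sim_between_mono)
qed

section \<open>Completeness: a weak step is played within one round\<close>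

abbreviation "L \<equiv> spine F"

text \<open>A silent step with its exact height above the running minimum, confined to heights below
  \<open>L\<close>.\<close>

fun tracked :: "tree \<times> nat \<times> nat \<Rightarrow> tree \<times> nat \<times> nat \<Rightarrow> bool" where
  "tracked (p, i, n) (q, j, n') \<longleftrightarrow> i < L \<and> j < L \<and>
     (\<exists>d. (p, tau, d, q) \<in> delta N' \<and> int n' = int n + d \<and> int j = max 0 (int i + d))"

text \<open>Once height \<open>L\<close> has been reached, the counter is arbitrary by an omega
  step, so of the remaining run only its path in the control graph is kept.\<close>

lemma tracked_or_climb:
  assumes "reach (p, m) (q, n)" "0 < L"
  shows "(\<exists>i < L. tracked\<^sup>*\<^sup>* (p, 0, m) (q, i, n)) \<or>
    (\<exists>s y s'. tracked\<^sup>*\<^sup>* (p, 0, m) (s, L - 1, y) \<and> (s, tau, 1, s') \<in> delta N' \<and>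
      (s', q) \<in> {(p, q). \<exists>d. (p, tau, d, q) \<in> delta N'}\<^sup>*)"
  using assms(1)
proof (induction rule: ocn_reach_induct)
  case refl
  then show ?case using assms(2) by blast
next
  case (step q n r x)
  from step(2) obtain d where d: "(q, tau, d, r) \<in> delta N'" "int x = int n + d" by auto
  from step.IH show ?case
  proof (elim disjE exE conjE)
    fix i assume i: "i < L" "tracked\<^sup>*\<^sup>* (p, 0, m) (q, i, n)"
    show ?thesis
    proof (cases "int i + d < L")
      case True
      then have "tracked (q, i, n) (r, nat (int i + d), x)" using i(1) d assms(2) by auto
      then have "tracked\<^sup>*\<^sup>* (p, 0, m) (r, nat (int i + d), x)"
        using i(2) rtranclp.rtrancl_into_rtrancl by metis
      moreover have "nat (int i + d) < L" using True assms(2) by simp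
      ultimately show ?thesis by blast
    next
      case False
      \<comment> \<open>Effects are at most 1, so height \<open>L\<close> can be attained only by an
        increment at \<open>L - 1\<close>.\<close>
      with i(1) ocn_states(4)[OF N' d(1)] have "d = 1" "i = L - 1" by auto
      with i(2) d(1) show ?thesis by blast
    qed
  next
    fix s y s'
    assume "tracked\<^sup>*\<^sup>* (p, 0, m) (s, L - 1, y)" "(s, tau, 1, s') \<in> delta N'"
      "(s', q) \<in> {(p, q). \<exists>d. (p, tau, d, q) \<in> delta N'}\<^sup>*"
    moreover from this(3) d(1) have "(s', r) \<in> {(p, q). \<exists>d. (p, tau, d, q) \<in> delta N'}\<^sup>*"
      by - (rule rtrancl_into_rtrancl[of s' q], auto)
    ultimately show ?thesis by blast
  qed
qed

lemma tracked_shift: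
  "(tracked ^^ k) (p, i, n) (q, j, n') \<Longrightarrow> (tracked ^^ k) (p, i, n + t) (q, j, n' + t)"
proof (induction k arbitrary: q j n')
  case (Suc k)
  from Suc.prems obtain r l x where "(tracked ^^ k) (p, i, n) (r, l, x)" "tracked (r, l, x) (q, j, n')"
    by (metis relpowp_Suc_E surj_pair)
  then have "(tracked ^^ k) (p, i, n + t) (r, l, x + t)" "tracked (r, l, x + t) (q, j, n' + t)"
    using Suc.IH by auto
  then show ?case by (rule relpowp_Suc_I)
qed auto

text \<open>The difference of counter and height is the running minimum, so it never increases and a
  repetition of state and height can be cut out without lowering the final counter.\<close>

lemma tracked_min:
  "(tracked ^^ k) (p, i, n) (q, j, n') \<Longrightarrow> int n' - int j \<le> int n - int i"
proof (induction k arbitrary: q j n')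
  case (Suc k)
  from Suc.prems obtain r l x where "(tracked ^^ k) (p, i, n) (r, l, x)" "tracked (r, l, x) (q, j, n')"
    by (metis relpowp_Suc_E surj_pair)
  then show ?case using Suc.IH[of r l x] by auto
qed auto

lemma tracked_states:
  "(tracked ^^ k) (p, i, n) (q, j, n') \<Longrightarrow> p \<in> states N' \<Longrightarrow> i < L \<Longrightarrow> q \<in> states N' \<and> j < L"
proof (induction k arbitrary: q j n')
  case (Suc k)
  from Suc.prems obtain r l x where "tracked (r, l, x) (q, j, n')"
    by (metis relpowp_Suc_E surj_pair)
  then show ?case using ocn_states(2)[OF N'] by auto
qed auto

lemma tracked_shorten:
  assumes "tracked\<^sup>*\<^sup>* (p, i, m) (q, j, n)" "p \<in> states N'" "i < L"
  shows "\<exists>k \<le> card (states N') * L. \<exists>n' \<ge> n. (tracked ^^ k) (p, i, m) (q, j, n')"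
proof -
  \<comment> \<open>The final counter may exceed \<open>n\<close>, because cutting out a repetition
    can raise it.\<close>
  let ?P = "\<lambda>k. \<exists>n' \<ge> n. (tracked ^^ k) (p, i, m) (q, j, n')"
  define k where "k = (LEAST k. ?P k)"
  have "\<exists>k. ?P k" using rtranclp_imp_relpowp[OF assms(1)] by blast
  then have "?P k" unfolding k_def by (rule LeastI_ex)
  then obtain n' where n': "n \<le> n'" "(tracked ^^ k) (p, i, m) (q, j, n')" by blast
  have "k \<le> card (states N') * L"
  proof (rule ccontr)
    assume long: "\<not> k \<le> card (states N') * L"
    obtain f where f: "f 0 = (p, i, m)" "f k = (q, j, n')"
      "\<And>u v. u \<le> v \<Longrightarrow> v \<le> k \<Longrightarrow> (tracked ^^ (v - u)) (f u) (f v)"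
      using relpowp_split[OF n'(2)] by blast
    define g where "g u = (fst (f u), fst (snd (f u)))" for u
    have "g u \<in> states N' \<times> {..<L}" if "u \<le> k" for u
    proof -
      obtain r l x where fu: "f u = (r, l, x)" by (metis surj_pair)
      then have "(tracked ^^ u) (p, i, m) (r, l, x)" using f(1) f(3)[of 0 u] that by simp
      from tracked_states[OF this assms(2,3)] show ?thesis by (simp add: g_def fu)
    qed
    then have "g ` {..k} \<subseteq> states N' \<times> {..<L}" by blast
    moreover have "finite (states N' \<times> {..<L})" using N' by (simp add: is_ocn_def)
    ultimately have "\<not> inj_on g {..k}"
      using card_inj_on_le[of g "{..k}" "states N' \<times> {..<L}"] long
      by (auto simp: card_cartesian_product)
    then obtain u v where uv: "u < v" "v \<le> k" "g u = g v"
      unfolding inj_on_def by (metis atMost_iff linorder_neqE_nat)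
    obtain r l x where fu: "f u = (r, l, x)" by (metis surj_pair)
    obtain x' where fv: "f v = (r, l, x')" using uv(3) fu unfolding g_def
      by (metis fst_conv prod.collapse snd_conv)
    have "(tracked ^^ (v - u)) (r, l, x) (r, l, x')" using f(3)[of u v] uv fu fv by simp
    then have "x' \<le> x" using tracked_min by fastforce
    have "(tracked ^^ (k - v)) (r, l, x') (q, j, n')" using f(3)[of v k] uv fv f(2) by simp
    \<comment> \<open>The remainder is replayed from the counter \<open>x\<close> before the
      repetition; it starts at the same height, so its heights do not change.\<close>
    then have "(tracked ^^ (k - v)) (r, l, x' + (x - x')) (q, j, n' + (x - x'))"
      by (rule tracked_shift)
    then have "(tracked ^^ (k - v)) (r, l, x) (q, j, n' + (x - x'))" using \<open>x' \<le> x\<close> by simp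
    moreover have "(tracked ^^ u) (p, i, m) (r, l, x)" using f(3)[of 0 u] f(1) uv fu by simp
    ultimately have "(tracked ^^ (u + (k - v))) (p, i, m) (q, j, n' + (x - x'))"
      by (rule relpowp_trans[rotated])
    moreover have "n \<le> n' + (x - x')" using n'(1) by simp
    ultimately have "?P (u + (k - v))" by blast
    moreover have "u + (k - v) < k" using uv by simp
    ultimately show False using not_less_Least unfolding k_def by blast
  qed
  then show ?thesis using n' by blast
qed

lemma aux_step_tracked:
  assumes "tracked (p, i, m) (q, j, n)" "b \<in> acts N'"
  shows "aux_step (phase Z b p (suffix_at F i), m) (phase Z b q (suffix_at F j), n)"
proof -
  obtain d where d: "(p, tau, d, q) \<in> delta N'" "int n = int m + d" "int j = max 0 (int i + d)"
    and ij: "i < L" "j < L" using assms(1) by auto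
  \<comment> \<open>The index \<open>s\<close> of the edge is the larger of the two heights; a
    decrement at height 0 uses \<open>Leaf\<close>.\<close>
  have "\<exists>s. s \<in> set (suffixes F) \<and> height_before d s = suffix_at F i \<and>
      height_after d s = suffix_at F j"
  proof -
    consider "d = 0" "j = i" | "d = 1" "j = Suc i" | "d = -1" "i = 0" "j = 0" | "d = -1" "i = Suc j"
      using ocn_states(4)[OF N' d(1)] d(3) by force
    then show ?thesis
    proof cases
      case 1
      then show ?thesis
        by (intro exI[of _ "suffix_at F i"]) (auto simp: suffix_at_in height_before_def height_after_def)
    next
      case 2
      then show ?thesis using right_suffix_at[OF ij(1)]
        by (intro exI[of _ "suffix_at F j"]) (auto simp: suffix_at_in height_before_def height_after_def)
    next
      case 3
      then show ?thesis
        by (intro exI[of _ "suffix_at F i"]) (auto simp: Leaf_in_suffixes height_before_def height_after_def)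
    next
      case 4
      then show ?thesis using right_suffix_at[OF ij(2)]
        by (intro exI[of _ "suffix_at F i"]) (auto simp: suffix_at_in height_before_def height_after_def)
    qed
  qed
  then obtain s where s: "s \<in> set (suffixes F)" "height_before d s = suffix_at F i"
    "height_after d s = suffix_at F j" by blast
  from aux_step_silent[OF d(1,2) assms(2) s(1)] show ?thesis unfolding s(2,3) .
qed

lemma aux_steps_tracked:
  assumes "(tracked ^^ k) (p, i, m) (q, j, n)" "b \<in> acts N'"
  shows "(aux_step ^^ k) (phase Z b p (suffix_at F i), m) (phase Z b q (suffix_at F j), n)"
  using assms(1)
proof (induction k arbitrary: q j n)
  case (Suc k)
  from Suc.prems obtain r l x where "(tracked ^^ k) (p, i, m) (r, l, x)" "tracked (r, l, x) (q, j, n)"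
    by (metis relpowp_Suc_E surj_pair)
  from Suc.IH[OF this(1)] aux_step_tracked[OF this(2) assms(2)] show ?case
    by (rule relpowp_Suc_I)
qed auto

text \<open>Each step costs at most one unit, so a reserve of \<open>k\<close> above
  \<open>n\<close> prevents blocking; heights stay at \<open>Leaf\<close>.\<close>

lemma aux_steps_graph:
  assumes "(s, q) \<in> {(p, q). \<exists>d. (p, tau, d, q) \<in> delta N'} ^^ k" "b \<in> acts N'" "n + k \<le> x"
  shows "\<exists>x' \<ge> n. (aux_step ^^ k) (phase Z b s Leaf, x) (phase Z b q Leaf, x')"
  using assms(1,3)
proof (induction k arbitrary: s x)
  case 0
  then show ?case by auto
next
  case (Suc k)
  from Suc.prems(1) obtain r d where d: "(s, tau, d, r) \<in> delta N'"
    and r: "(r, q) \<in> {(p, q). \<exists>d. (p, tau, d, q) \<in> delta N'} ^^ k"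
    using relpow_Suc_D2[OF Suc.prems(1)] by blast
  have "-1 \<le> d" using ocn_states(4)[OF N' d] by auto
  then have x: "int (nat (int x + d)) = int x + d" "n + k \<le> nat (int x + d)"
    using Suc.prems(2) by auto
  have "aux_step (phase Z b s Leaf, x) (phase Z b r Leaf, nat (int x + d))"
    using aux_step_silent[OF d x(1) assms(2) Leaf_in_suffixes]
    by (simp add: height_Leaf del: omega_lts.simps)
  with Suc.IH[OF r x(2)] show ?case by (meson relpowp_Suc_I2)
qed

text \<open>The bound adds the pairs of state and height of a tracked run, the edges of a path in
  the control graph, and 2 for the climb to \<open>F\<close> and the omega step. A run that stays
  tracked needs only a final reset.\<close>

lemma aux_steps_reach:
  assumes "reach (p, m) (q, n)" "p \<in> states N'" "b \<in> acts N'"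
  shows "\<exists>k \<le> card (states N') * L + card (delta N') + 2.
    \<exists>n' \<ge> n. (aux_step ^^ k) (phase Z b p Leaf, m) (phase Z b q Leaf, n')"
proof -
  let ?E = "{(p, q). \<exists>d. (p, tau, d, q) \<in> delta N'}"
  have fin: "finite (states N')" "finite (acts N')" "delta N' \<subseteq> states N' \<times> acts N' \<times> {-1, 0, 1} \<times> states N'"
    using N' by (auto simp: is_ocn_def)
  then have fin_delta: "finite (delta N')" by (auto intro: finite_subset)
  have "0 < card (states N')" using fin(1) assms(2) card_gt_0_iff by blast
  then have L: "0 < L" using F_long by simp
  have q: "q \<in> states N'" using ocn_reach_states[OF N' assms(1,2)] .
  from tracked_or_climb[OF assms(1) L] show ?thesis
  proof (elim disjE exE conjE)
    fix i assume "i < L" "tracked\<^sup>*\<^sup>* (p, 0, m) (q, i, n)"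
    with tracked_shorten[OF _ assms(2) L] obtain k n' where
      k: "k \<le> card (states N') * L" "n \<le> n'" "(tracked ^^ k) (p, 0, m) (q, i, n')" by blast
    have "(aux_step ^^ k) (phase Z b p Leaf, m) (phase Z b q (suffix_at F i), n')"
      using aux_steps_tracked[OF k(3) assms(3)] by simp
    then have "(aux_step ^^ Suc k) (phase Z b p Leaf, m) (phase Z b q Leaf, n')"
      using aux_step_reset[OF q assms(3) suffix_at_in] by (rule relpowp_Suc_I)
    moreover have "Suc k \<le> card (states N') * L + card (delta N') + 2" using k(1) by simp
    ultimately show ?thesis using k(2) by blast
  next
    fix s y s'
    assume climb: "tracked\<^sup>*\<^sup>* (p, 0, m) (s, L - 1, y)" and s': "(s, tau, 1, s') \<in> delta N'"
      and graph: "(s', q) \<in> ?E\<^sup>*"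
    from tracked_shorten[OF climb assms(2) L] obtain k y' where
      k: "k \<le> card (states N') * L" "(tracked ^^ k) (p, 0, m) (s, L - 1, y')" by blast
    have E: "?E \<subseteq> (\<lambda>(p, a, d, q). (p, q)) ` delta N'" by force
    then have "finite ?E" using fin_delta finite_surj by blast
    \<comment> \<open>Reachability in a finite relation needs no more steps than the relation has
      pairs.\<close>
    then obtain k' where k': "k' \<le> card ?E" "(s', q) \<in> ?E ^^ k'"
      using graph rtrancl_finite_eq_relpow by blast
    have "card ?E \<le> card (delta N')" using E fin_delta by (rule surj_card_le[rotated])
    have up: "aux_step (phase Z b s (suffix_at F (L - 1)), y') (phase Z b s' F, Suc y')"
      using aux_step_silent[OF s' _ assms(3) self_in_suffixes, of "Suc y'" y']
        right_suffix_at[of "L - 1" F] L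
      by (simp add: height_before_def height_after_def del: omega_lts.simps)
    \<comment> \<open>Strictly above \<open>Suc y'\<close>, as the omega step demands, with a
      reserve of \<open>k'\<close> above \<open>n\<close> for the path that follows.\<close>
    define x where "x = Suc (Suc y') + n + k'"
    have "aux_step (phase Z b s' F, Suc y') (phase Z b s' Leaf, x)"
      using ocn_states(2)[OF N' s'] assms(3) by (intro aux_step_omega) (auto simp: x_def)
    moreover have "(aux_step ^^ Suc k) (phase Z b p Leaf, m) (phase Z b s' F, Suc y')"
      using aux_steps_tracked[OF k(2) assms(3)] up by (intro relpowp_Suc_I) auto
    ultimately have "(aux_step ^^ Suc (Suc k)) (phase Z b p Leaf, m) (phase Z b s' Leaf, x)"
      by (rule relpowp_Suc_I[rotated])
    moreover obtain n' where n': "n \<le> n'"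
      "(aux_step ^^ k') (phase Z b s' Leaf, x) (phase Z b q Leaf, n')"
      using aux_steps_graph[OF k'(2) assms(3), of n x] by (auto simp: x_def)
    ultimately have "(aux_step ^^ (Suc (Suc k) + k')) (phase Z b p Leaf, m) (phase Z b q Leaf, n')"
      by (blast intro: relpowp_trans)
    moreover have "Suc (Suc k) + k' \<le> card (states N') * L + card (delta N') + 2"
      using k(1) k'(1) \<open>card ?E \<le> card (delta N')\<close> by simp
    ultimately show ?thesis using n'(1) by blast
  qed
qed

text \<open>A reset at height \<open>Leaf\<close> is an idle step; it fills the round up to its
  fixed length.\<close>

lemma aux_steps_pad:
  assumes "(aux_step ^^ k) y (phase Z b q Leaf, n)" "k \<le> k'" "q \<in> states N'" "b \<in> acts N'"
  shows "(aux_step ^^ k') y (phase Z b q Leaf, n)"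
  using assms(2)
proof (induction rule: dec_induct)
  case base
  show ?case by (fact assms(1))
next
  case (step k')
  from step.IH aux_step_reset[OF assms(3,4) Leaf_in_suffixes] show ?case
    by (rule relpowp_Suc_I)
qed

lemma aux_steps_weak_step:
  assumes "weak_step (ocn_lts N') tau a (p, m) (q, n)" "p \<in> states N'" "a \<in> acts N'"
  shows "\<exists>n' \<ge> n. (aux_step ^^ spine K) (phase Z a p Leaf, m) (phase Z tau q Leaf, n')"
proof -
  let ?B = "card (states N') * L + card (delta N') + 2"
  have K: "2 * ?B + 1 \<le> spine K" using K_long assms(2) by blast
  have "\<exists>k \<le> 2 * ?B + 1. \<exists>n' \<ge> n. q \<in> states N' \<and>
      (aux_step ^^ k) (phase Z a p Leaf, m) (phase Z tau q Leaf, n')"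
  proof (cases "a = tau")
    case True
    with assms(1) have r: "reach (p, m) (q, n)" by (simp add: weak_step_ocn_tau)
    from aux_steps_reach[OF r assms(2,3)] obtain k n' where "k \<le> ?B" "n \<le> n'"
      "(aux_step ^^ k) (phase Z a p Leaf, m) (phase Z a q Leaf, n')" by blast
    then show ?thesis
      using True ocn_reach_states[OF N' r assms(2)] by (intro exI[of _ k] conjI exI[of _ n']) auto
  next
    case False
    then obtain p1 m1 p2 m2 where r: "reach (p, m) (p1, m1)" "ocn_lts N' (p1, m1) a (p2, m2)"
      "reach (p2, m2) (q, n)"
      using assms(1) unfolding weak_step_ocn_visible[OF False] by (metis surj_pair)
    from r(2) obtain d where d: "(p1, a, d, p2) \<in> delta N'" "int m2 = int m1 + d" by auto
    from aux_steps_reach[OF r(1) assms(2,3)] obtain k1 x1 where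
      1: "k1 \<le> ?B" "m1 \<le> x1" "(aux_step ^^ k1) (phase Z a p Leaf, m) (phase Z a p1 Leaf, x1)"
      by blast
    \<comment> \<open>The surplus gained before the visible step is carried through the rest of the
      weak step by shifting.\<close>
    define t where "t = x1 - m1"
    have "aux_step (phase Z a p1 Leaf, x1) (phase Z tau p2 Leaf, m2 + t)"
      using d 1(2) by (intro aux_step_visible[OF d(1)]) (simp add: t_def)
    with 1(3) have 2: "(aux_step ^^ Suc k1) (phase Z a p Leaf, m) (phase Z tau p2 Leaf, m2 + t)"
      by (rule relpowp_Suc_I)
    have p2: "p2 \<in> states N'" using ocn_states(2)[OF N' d(1)] .
    from aux_steps_reach[OF ocn_reach_shift[OF r(3)] p2 tau, of t] obtain k2 n' where
      3: "k2 \<le> ?B" "n + t \<le> n'"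
        "(aux_step ^^ k2) (phase Z tau p2 Leaf, m2 + t) (phase Z tau q Leaf, n')" by blast
    have "(aux_step ^^ (Suc k1 + k2)) (phase Z a p Leaf, m) (phase Z tau q Leaf, n')"
      using 2 3(3) by (rule relpowp_trans)
    moreover have "Suc k1 + k2 \<le> 2 * ?B + 1" "n \<le> n'" using 1(1) 3(1,2) by auto
    ultimately show ?thesis using ocn_reach_states[OF N' r(3) p2] by blast
  qed
  then show ?thesis using aux_steps_pad[OF _ _ _ tau] K by (meson le_trans)
qed

lemma strong_sim_if_weak_sim:
  assumes "q \<in> states N" "q' \<in> states N'"
    and "weak_sim_between (ocn_lts N) (ocn_lts N') tau (q, n) (q', n')"
  shows "strong_sim_between (ocn_lts M) (omega_lts M') (q, n) (q', n')"
proof -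
  define W where "W = weak_sim_between (ocn_lts N) (ocn_lts N') tau"
  \<comment> \<open>Inside a round it is enough that some plan remains: in exactly the number of
    steps left on Spoiler's chain, Duplicator can reach phase \<open>tau\<close> at a configuration
    that weakly simulates Spoiler's.\<close>
  define R where "R c c' \<longleftrightarrow>
     (\<exists>q n q' n'. c = (q, n) \<and> c' = (q', n') \<and> q \<in> states N \<and> q' \<in> states N' \<and> W c c') \<or>
     (\<exists>q s n p m. c = (chain Z q s, n) \<and> q \<in> states N \<and> p \<in> states N' \<and>
       (aux_step ^^ spine s) c' (phase Z tau p Leaf, m) \<and> W (q, n) (p, m))"
    for c c' :: "tree \<times> nat"
  have "\<exists>d'. omega_lts M' c' a d' \<and> R d d'" if "R c c'" and step: "ocn_lts M c a d" for c c' a d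
    using that(1) unfolding R_def[of c c']
  proof (elim disjE exE conjE)
    fix q n q' n'
    assume c: "c = (q, n)" "c' = (q', n')" "q \<in> states N" "q' \<in> states N'" and "W c c'"
    then have sim: "weak_sim_between (ocn_lts N) (ocn_lts N') tau (q, n) (q', n')"
      by (simp add: W_def)
    from step obtain q2 n2 where d: "d = (chain Z q2 K, n2)" and step': "ocn_lts N (q, n) a (q2, n2)"
      unfolding c(1) M_state_step[OF c(3)] by blast
    from weak_sim_between_step[OF sim step'] obtain r m where
      r: "weak_step (ocn_lts N') tau a (q', n') (r, m)"
        "weak_sim_between (ocn_lts N) (ocn_lts N') tau (q2, n2) (r, m)" by auto
    \<comment> \<open>Announcements exist only for actions of the second net; that \<open>a\<close>
      is one of them follows from the existence of a weak response.\<close>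
    have a: "a \<in> acts N' \<and> r \<in> states N'"
    proof (cases "a = tau")
      case True
      with r(1) show ?thesis using tau ocn_reach_states[OF N' _ c(4)]
        by (auto simp: weak_step_ocn_tau)
    next
      case False
      then obtain p1 m1 p2 m2 where "ocn_lts N' (p1, m1) a (p2, m2)" "reach (p2, m2) (r, m)"
        using r(1) unfolding weak_step_ocn_visible[OF False] by (metis surj_pair)
      then show ?thesis using ocn_states[OF N'] ocn_reach_states[OF N'] by auto
    qed
    then obtain m' where m': "m \<le> m'"
      "(aux_step ^^ spine K) (phase Z a q' Leaf, n') (phase Z tau r Leaf, m')"
      using aux_steps_weak_step[OF r(1) c(4)] by blast
    have "q2 \<in> states N" using step' ocn_states(2)[OF N] by auto
    then have "R d (phase Z a q' Leaf, n')"
      unfolding R_def d W_def using m'(2) weak_sim_between_mono[OF r(2) m'(1)] a by blast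
    moreover have "omega_lts M' c' a (phase Z a q' Leaf, n')"
      unfolding c(2) M'_state_step[OF c(4)] using a by simp
    ultimately show ?thesis by blast
  next
    fix q s n p m
    assume c: "c = (chain Z q s, n)" "q \<in> states N" "p \<in> states N'"
      and steps: "(aux_step ^^ spine s) c' (phase Z tau p Leaf, m)" and W: "W (q, n) (p, m)"
    show ?thesis
    proof (cases s)
      case Leaf
      with step have d: "a = end_round" "d = (q, n)"
        unfolding c(1) M_chain_step by auto
      from Leaf steps have c': "c' = (phase Z tau p Leaf, m)" by simp
      have "omega_lts M' c' a (p, m)"
        unfolding c' d(1) M'_end_round_step using c(3) Leaf_in_suffixes by blast
      moreover have "R d (p, m)" unfolding R_def d(2) using c W by blast
      ultimately show ?thesis by blast
    next
      case (Node l r)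
      with step have d: "a = Leaf" "d = (chain Z q r, n)"
        unfolding c(1) M_chain_step by auto
      from steps Node obtain y where y: "aux_step c' y" "(aux_step ^^ spine r) y (phase Z tau p Leaf, m)"
        by (metis relpowp_Suc_E2 spine.simps(2))
      then have "R d y" unfolding R_def d(2) using c W by blast
      with y(1) d(1) show ?thesis by blast
    qed
  qed
  moreover have "R (q, n) (q', n')" using assms unfolding R_def W_def by blast
  ultimately show ?thesis by (intro strong_sim_betweenI[of R])
qed

lemma weak_sim_iff_strong_sim:
  assumes "q \<in> states N" "q' \<in> states N'"
  shows "weak_sim_between (ocn_lts N) (ocn_lts N') tau (q, n) (q', n') \<longleftrightarrow>
    strong_sim_between (ocn_lts M) (omega_lts M') (q, n) (q', n')"
  using weak_sim_if_strong_sim strong_sim_if_weak_sim assms by blast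

end

section \<open>Computing the translation\<close>

lemma size_in_enc_list: "x \<in> set xs \<Longrightarrow> size x \<le> size (enc_list xs)"
  by (induction xs) auto

lemma spine_enc_list [simp]: "spine (enc_list xs) = length xs"
  by (induction xs) auto

lemma length_suffixes [simp]: "length (suffixes t) = Suc (spine t)"
  by (induction t) auto

lemma spine_append_enc_list [simp]: "spine_append (enc_list xs) (enc_list ys) = enc_list (xs @ ys)"
  by (induction xs) auto

lemma spine_concat_items:
  assumes "\<And>x. x \<in> set xs \<Longrightarrow> h x = enc_list (k x)"
  shows "spine_concat (\<lambda>s. h (left s)) (enc_list xs) = enc_list (concat (map k xs))"
  using assms by (induction xs) auto

text \<open>A loop visits nonempty suffixes only. The dummy cell in front shifts it by one, so that
  \<open>right s\<close> runs through all suffixes of \<open>t\<close>, from \<open>t\<close> itself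
  down to \<open>Leaf\<close>.\<close>

lemma spine_concat_suffixes:
  assumes "\<And>s. h s = enc_list (k s)"
  shows "spine_concat (\<lambda>s. h (right s)) (Node l t) = enc_list (concat (map k (suffixes t)))"
  using spine_append_enc_list[of _ "[]"] by (induction t arbitrary: l) (auto simp: assms)

section \<open>The translation as a program on trees\<close>

definition enc_edge :: "tree \<Rightarrow> tree \<Rightarrow> tree \<Rightarrow> tree \<Rightarrow> tree" where
  "enc_edge p a d q = Node p (Node a (Node d q))"

text \<open>The effect is read off its code: \<open>Leaf\<close> is 0, and of the two nonempty codes
  only that of -1 has a nonempty right subtree.\<close>

definition enc_before :: "tree \<Rightarrow> tree \<Rightarrow> tree" where
  "enc_before d s = (if d \<noteq> Leaf then if right d \<noteq> Leaf then s else right s else s)"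

definition enc_after :: "tree \<Rightarrow> tree \<Rightarrow> tree" where
  "enc_after d s = (if right d \<noteq> Leaf then right s else s)"

lemma enc_before_int: "d \<in> {-1, 0, 1} \<Longrightarrow> enc_before (enc_int d) s = height_before d s"
  by (auto simp: enc_before_def enc_int_def height_before_def)

lemma enc_after_int: "d \<in> {-1, 0, 1} \<Longrightarrow> enc_after (enc_int d) s = height_after d s"
  by (auto simp: enc_after_def enc_int_def height_after_def)

text \<open>Here \<open>t\<close> encodes a transition of the second net. Its effect code is copied
  verbatim, as \<open>enc_effect\<close> extends \<open>enc_int\<close>. The first edge does not
  depend on \<open>b\<close> and is emitted once per action; repetitions are harmless in a list that
  stands for a set.\<close>

definition dup_move_edges :: "tree \<Rightarrow> tree \<Rightarrow> tree \<Rightarrow> tree \<Rightarrow> tree \<Rightarrow> tree" where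
  "dup_move_edges tau z b s t = Node
     (enc_edge (phase z (left (right t)) (left t) s) Leaf (left (right (right t)))
       (phase z tau (right (right (right t))) Leaf))
     (if left (right t) = tau then Node
        (enc_edge (phase z b (left t) (enc_before (left (right (right t))) s)) Leaf
          (left (right (right t)))
          (phase z b (right (right (right t))) (enc_after (left (right (right t))) s))) Leaf
      else Leaf)"

text \<open>In the third edge \<open>left (right z)\<close> is the state list of the second net,
  that is, the top height \<open>F\<close>.\<close>

definition dup_state_edges :: "tree \<Rightarrow> tree \<Rightarrow> tree \<Rightarrow> tree \<Rightarrow> tree \<Rightarrow> tree" where
  "dup_state_edges tau z b s p = enc_list
     [enc_edge (phase z b p s) Leaf Leaf (phase z b p Leaf),
      enc_edge (phase z tau p s) end_round Leaf p,
      enc_edge (phase z b p (left (right z))) Leaf (enc_effect Omega) (phase z b p Leaf),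
      enc_edge p b Leaf (phase z b p Leaf)]"

text \<open>The loops run over actions, then heights, then transitions and states of the net
  \<open>right z\<close>; the dummy cell makes the height loop include \<open>Leaf\<close>.\<close>

definition dup_delta :: "tree \<Rightarrow> tree \<Rightarrow> tree" where
  "dup_delta tau z = spine_concat (\<lambda>u. spine_concat (\<lambda>v. spine_append
     (spine_concat (\<lambda>w. dup_move_edges tau z (left u) (right v) (left w)) (right (right (right z))))
     (spine_concat (\<lambda>w. dup_state_edges tau z (left u) (right v) (left w)) (left (right z))))
     (Node Leaf (left (right z)))) (left (right (right z)))"

definition dup_states :: "tree \<Rightarrow> tree" where
  "dup_states z = spine_append (left (right z)) (spine_concat (\<lambda>u. spine_concat (\<lambda>v.
     spine_concat (\<lambda>w. Node (phase z (left u) (left w) (right v)) Leaf) (left (right z)))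
     (Node Leaf (left (right z)))) (left (right (right z))))"

definition spoiler_step_edge :: "tree \<Rightarrow> tree \<Rightarrow> tree \<Rightarrow> tree" where
  "spoiler_step_edge z q s = (if s \<noteq> Leaf
     then enc_edge (chain z q s) Leaf Leaf (chain z q (right s))
     else enc_edge (chain z q Leaf) end_round Leaf q)"

text \<open>The list \<open>dup_delta tau z\<close> plays the role of the clock
  \<open>K\<close>.\<close>

definition spoiler_delta :: "tree \<Rightarrow> tree \<Rightarrow> tree" where
  "spoiler_delta tau z = spine_append
     (spine_concat (\<lambda>u. Node (enc_edge (left (left u)) (left (right (left u)))
        (left (right (right (left u)))) (chain z (right (right (right (left u)))) (dup_delta tau z))) Leaf)
        (right (right (left z))))
     (spine_concat (\<lambda>u. spine_concat (\<lambda>v. Node (spoiler_step_edge z (left u) (right v)) Leaf)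
        (Node Leaf (dup_delta tau z))) (left (left z)))"

definition spoiler_states :: "tree \<Rightarrow> tree \<Rightarrow> tree" where
  "spoiler_states tau z = spine_append (left (left z)) (spine_concat (\<lambda>u. spine_concat (\<lambda>v.
     Node (chain z (left u) (right v)) Leaf) (Node Leaf (dup_delta tau z))) (left (left z)))"

definition translate :: "tree \<Rightarrow> tree \<Rightarrow> tree" where
  "translate tau z = Node
     (Node (spoiler_states tau z)
       (Node (Node Leaf (Node end_round (left (right (left z))))) (spoiler_delta tau z)))
     (Node (dup_states z)
       (Node (Node Leaf (Node end_round (left (right (right z))))) (dup_delta tau z)))"

section \<open>Polynomial running time of the translation\<close>

lemmas fp_rules = fp_node fp_left fp_right fp_if fp_if_eq fp_var fp_spine_append fp_const

lemma fp_spine_concat':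
  assumes "fp (Suc n) H" "fp n X" "\<And>s vs. length vs = n \<Longrightarrow> H (s # vs) = G s vs"
  shows "fp n (\<lambda>vs. spine_concat (\<lambda>s. G s vs) (X vs))"
  using fp_spine_concat[OF assms(1,2)] by (rule fp_cong) (simp add: assms(3))

text \<open>The nested loops are compiled from the inside out. Argument 0 is always the innermost
  open loop variable and the last argument is the input, so closing a loop lowers every index by
  one.\<close>

lemma fp_dup_delta: "fp 1 (\<lambda>vs. dup_delta tau (vs ! 0))"
proof -
  have "fp (Suc (Suc (Suc 1))) (\<lambda>vs. dup_move_edges tau (vs ! 3) (left (vs ! 2)) (right (vs ! 1)) (left (vs ! 0)))"
    unfolding dup_move_edges_def enc_edge_def phase_def enc_before_def enc_after_def
    by (intro fp_rules) auto
  then have 1: "fp (Suc (Suc 1)) (\<lambda>vs. spine_concat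
      (\<lambda>w. dup_move_edges tau (vs ! 2) (left (vs ! 1)) (right (vs ! 0)) (left w)) (right (right (right (vs ! 2)))))"
    by (rule fp_spine_concat') ((intro fp_rules)?, simp)+
  have "fp (Suc (Suc (Suc 1))) (\<lambda>vs. dup_state_edges tau (vs ! 3) (left (vs ! 2)) (right (vs ! 1)) (left (vs ! 0)))"
    unfolding dup_state_edges_def enc_edge_def phase_def enc_list.simps
    by (intro fp_rules) auto
  then have 2: "fp (Suc (Suc 1)) (\<lambda>vs. spine_concat
      (\<lambda>w. dup_state_edges tau (vs ! 2) (left (vs ! 1)) (right (vs ! 0)) (left w)) (left (right (vs ! 2))))"
    by (rule fp_spine_concat') ((intro fp_rules)?, simp)+
  from fp_spine_append[OF 1 2] have "fp (Suc 1) (\<lambda>vs. spine_concat (\<lambda>v. spine_append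
      (spine_concat (\<lambda>w. dup_move_edges tau (vs ! 1) (left (vs ! 0)) (right v) (left w)) (right (right (right (vs ! 1)))))
      (spine_concat (\<lambda>w. dup_state_edges tau (vs ! 1) (left (vs ! 0)) (right v) (left w)) (left (right (vs ! 1)))))
      (Node Leaf (left (right (vs ! 1)))))"
    by (rule fp_spine_concat') ((intro fp_rules)?, simp)+
  then show ?thesis unfolding dup_delta_def
    by (rule fp_spine_concat') ((intro fp_rules)?, simp)+
qed

lemma fp_dup_states: "fp 1 (\<lambda>vs. dup_states (vs ! 0))"
proof -
  have "fp (Suc (Suc (Suc 1))) (\<lambda>vs. Node (phase (vs ! 3) (left (vs ! 2)) (left (vs ! 0)) (right (vs ! 1))) Leaf)"
    unfolding phase_def by (intro fp_rules) auto
  then have "fp (Suc (Suc 1)) (\<lambda>vs. spine_concat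
      (\<lambda>w. Node (phase (vs ! 2) (left (vs ! 1)) (left w) (right (vs ! 0))) Leaf) (left (right (vs ! 2))))"
    by (rule fp_spine_concat') ((intro fp_rules)?, simp)+
  then have "fp (Suc 1) (\<lambda>vs. spine_concat (\<lambda>v. spine_concat
      (\<lambda>w. Node (phase (vs ! 1) (left (vs ! 0)) (left w) (right v)) Leaf) (left (right (vs ! 1))))
      (Node Leaf (left (right (vs ! 1)))))"
    by (rule fp_spine_concat') ((intro fp_rules)?, simp)+
  then have "fp 1 (\<lambda>vs. spine_concat (\<lambda>u. spine_concat (\<lambda>v. spine_concat
      (\<lambda>w. Node (phase (vs ! 0) (left u) (left w) (right v)) Leaf) (left (right (vs ! 0))))
      (Node Leaf (left (right (vs ! 0))))) (left (right (right (vs ! 0)))))"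
    by (rule fp_spine_concat') ((intro fp_rules)?, simp)+
  then show ?thesis unfolding dup_states_def
    by (intro fp_spine_append) (intro fp_rules, simp)
qed

lemma fp_spoiler_delta: "fp 1 (\<lambda>vs. spoiler_delta tau (vs ! 0))"
proof -
  have K: "fp n (\<lambda>vs. dup_delta tau (vs ! i))" if "i < n" for n i
    by (rule fp_comp1[OF fp_dup_delta]) (rule fp_var[OF that])
  have "fp (Suc 1) (\<lambda>vs. Node (enc_edge (left (left (vs ! 0))) (left (right (left (vs ! 0))))
      (left (right (right (left (vs ! 0)))))
      (chain (vs ! 1) (right (right (right (left (vs ! 0))))) (dup_delta tau (vs ! 1)))) Leaf)"
    unfolding enc_edge_def chain_def by (intro fp_rules K) auto
  then have 1: "fp 1 (\<lambda>vs. spine_concat (\<lambda>u. Node (enc_edge (left (left u)) (left (right (left u)))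
      (left (right (right (left u))))
      (chain (vs ! 0) (right (right (right (left u)))) (dup_delta tau (vs ! 0)))) Leaf)
      (right (right (left (vs ! 0)))))"
    by (rule fp_spine_concat') ((intro fp_rules)?, simp)+
  have "fp (Suc (Suc 1)) (\<lambda>vs. Node (spoiler_step_edge (vs ! 2) (left (vs ! 1)) (right (vs ! 0))) Leaf)"
    unfolding spoiler_step_edge_def enc_edge_def chain_def by (intro fp_rules) auto
  then have "fp (Suc 1) (\<lambda>vs. spine_concat
      (\<lambda>v. Node (spoiler_step_edge (vs ! 1) (left (vs ! 0)) (right v)) Leaf) (Node Leaf (dup_delta tau (vs ! 1))))"
    by (rule fp_spine_concat') ((intro fp_rules K)?, simp)+
  then have 2: "fp 1 (\<lambda>vs. spine_concat (\<lambda>u. spine_concat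
      (\<lambda>v. Node (spoiler_step_edge (vs ! 0) (left u) (right v)) Leaf) (Node Leaf (dup_delta tau (vs ! 0))))
      (left (left (vs ! 0))))"
    by (rule fp_spine_concat') ((intro fp_rules)?, simp)+
  from fp_spine_append[OF 1 2] show ?thesis unfolding spoiler_delta_def .
qed

lemma fp_spoiler_states: "fp 1 (\<lambda>vs. spoiler_states tau (vs ! 0))"
proof -
  have K: "fp n (\<lambda>vs. dup_delta tau (vs ! i))" if "i < n" for n i
    by (rule fp_comp1[OF fp_dup_delta]) (rule fp_var[OF that])
  have "fp (Suc (Suc 1)) (\<lambda>vs. Node (chain (vs ! 2) (left (vs ! 1)) (right (vs ! 0))) Leaf)"
    unfolding chain_def by (intro fp_rules) auto
  then have "fp (Suc 1) (\<lambda>vs. spine_concat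
      (\<lambda>v. Node (chain (vs ! 1) (left (vs ! 0)) (right v)) Leaf) (Node Leaf (dup_delta tau (vs ! 1))))"
    by (rule fp_spine_concat') ((intro fp_rules K)?, simp)+
  then have "fp 1 (\<lambda>vs. spine_concat (\<lambda>u. spine_concat
      (\<lambda>v. Node (chain (vs ! 0) (left u) (right v)) Leaf) (Node Leaf (dup_delta tau (vs ! 0))))
      (left (left (vs ! 0))))"
    by (rule fp_spine_concat') ((intro fp_rules)?, simp)+
  then show ?thesis unfolding spoiler_states_def
    by (intro fp_spine_append) (intro fp_rules, simp)
qed

lemma polytime_translate: "polytime_on A (translate tau)"
  unfolding translate_def
  by (rule polytime_on_fp)
    (intro fp_node fp_spoiler_states fp_spoiler_delta fp_dup_states fp_dup_delta fp_const
      fp_left fp_right fp_var; simp)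

section \<open>The output encodes the two nets\<close>

definition dup_edge_list :: "tree \<Rightarrow> tree \<Rightarrow> tree list \<Rightarrow> tree list \<Rightarrow>
    (tree \<times> tree \<times> int \<times> tree) list \<Rightarrow> (tree \<times> tree \<times> effect \<times> tree) list" where
  "dup_edge_list tau z Qs As Ds = concat (map (\<lambda>b. concat (map (\<lambda>s.
     concat (map (\<lambda>(p, a, d, q). (phase z a p s, Leaf, Fin d, phase z tau q Leaf) #
       (if a = tau then [(phase z b p (height_before d s), Leaf, Fin d,
          phase z b q (height_after d s))] else [])) Ds) @
     concat (map (\<lambda>p. [(phase z b p s, Leaf, Fin 0, phase z b p Leaf),
       (phase z tau p s, end_round, Fin 0, p),
       (phase z b p (enc_list Qs), Leaf, Omega, phase z b p Leaf),
       (p, b, Fin 0, phase z b p Leaf)]) Qs)) (suffixes (enc_list Qs)))) As)"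

text \<open>Both sides run the same loops in the same order, so the encodings agree as lists.
  Effects are restricted because the program recognises them by their codes.\<close>

lemma dup_delta_enc:
  assumes z: "z = Node x (Node (enc_list Qs) (Node (enc_list As) (enc_list (map (enc_trans enc_int) Ds))))"
    and Ds: "\<And>p a d q. (p, a, d, q) \<in> set Ds \<Longrightarrow> d \<in> {-1, 0, 1}"
  shows "dup_delta tau z = enc_list (map (enc_trans enc_effect) (dup_edge_list tau z Qs As Ds))"
proof -
  let ?e = "enc_trans enc_effect"
  have sel: "left (right z) = enc_list Qs" "left (right (right z)) = enc_list As"
    "right (right (right z)) = enc_list (map (enc_trans enc_int) Ds)"
    by (simp_all add: z)
  define m where "m b s = (\<lambda>(p, a, d, q). (phase z a p s, Leaf, Fin d, phase z tau q Leaf) #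
       (if a = tau then [(phase z b p (height_before d s), Leaf, Fin d,
          phase z b q (height_after d s))] else []))" for b s
  define n where "n b s = (\<lambda>p. [(phase z b p s, Leaf, Fin 0, phase z b p Leaf),
       (phase z tau p s, end_round, Fin 0, p),
       (phase z b p (enc_list Qs), Leaf, Omega, phase z b p Leaf),
       (p, b, Fin 0, phase z b p Leaf)])" for b s
  have m: "dup_move_edges tau z b s (enc_trans enc_int t) = enc_list (map ?e (m b s t))"
    if "t \<in> set Ds" for b s t
  proof -
    obtain p a d q where t: "t = (p, a, d, q)" by (metis surj_pair)
    show ?thesis using Ds[of p a d q] that
      by (auto simp: t m_def dup_move_edges_def enc_edge_def enc_before_int enc_after_int)
  qed
  have n: "dup_state_edges tau z b s p = enc_list (map ?e (n b s p))" for b s p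
    by (simp add: n_def dup_state_edges_def enc_edge_def sel enc_int_def)
  have 1: "spine_concat (\<lambda>w. dup_move_edges tau z b s (left w)) (enc_list (map (enc_trans enc_int) Ds)) =
      enc_list (map ?e (concat (map (m b s) Ds)))" for b s
  proof -
    have "spine_concat (\<lambda>w. h (left w)) (enc_list (map f Ds)) = enc_list (concat (map k Ds))"
      if "\<And>t. t \<in> set Ds \<Longrightarrow> h (f t) = enc_list (k t)" for h f k
      using that by (induction Ds) auto
    from this[of "dup_move_edges tau z b s" "enc_trans enc_int", OF m] show ?thesis
      by (simp add: map_concat comp_def)
  qed
  have 2: "spine_concat (\<lambda>w. dup_state_edges tau z b s (left w)) (enc_list Qs) =
      enc_list (map ?e (concat (map (n b s) Qs)))" for b s
    by (subst spine_concat_items[OF n]) (simp add: map_concat comp_def)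
  have 3: "spine_concat (\<lambda>v. spine_append
      (spine_concat (\<lambda>w. dup_move_edges tau z b (right v) (left w)) (enc_list (map (enc_trans enc_int) Ds)))
      (spine_concat (\<lambda>w. dup_state_edges tau z b (right v) (left w)) (enc_list Qs)))
      (Node Leaf (enc_list Qs)) =
    enc_list (map ?e (concat (map (\<lambda>s. concat (map (m b s) Ds) @ concat (map (n b s) Qs))
      (suffixes (enc_list Qs)))))" for b
    unfolding 1 2 spine_append_enc_list
    by (subst spine_concat_suffixes[where h = "\<lambda>s. enc_list (map ?e (concat (map (m b s) Ds)) @
          map ?e (concat (map (n b s) Qs)))", OF refl]) (simp add: map_concat comp_def)
  show ?thesis
    unfolding dup_delta_def sel
    by (subst spine_concat_items[OF 3])
      (simp add: dup_edge_list_def m_def n_def map_concat comp_def)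
qed

lemma set_dup_edge_list:
  assumes "set Qs = states N" "set As = acts N" "set Ds = delta N" "tau \<in> acts N"
  shows "set (dup_edge_list tau z Qs As Ds) = delta (duplicator_net tau z (enc_list Qs) N)"
    (is "?l = ?r")
proof
  have F: "enc_list Qs \<in> set (suffixes (enc_list Qs))" by (rule self_in_suffixes)
  show "?l \<subseteq> ?r"
    unfolding dup_edge_list_def duplicator_net_def assms(1-3)[symmetric]
    by (auto split: if_splits)
  show "?r \<subseteq> ?l"
  proof
    fix e assume "e \<in> ?r"
    then consider
      (1) p a d q s where "e = (phase z a p s, Leaf, Fin d, phase z tau q Leaf)"
        "(p, a, d, q) \<in> set Ds" "s \<in> set (suffixes (enc_list Qs))"
    | (2) p d q b s where "e = (phase z b p (height_before d s), Leaf, Fin d, phase z b q (height_after d s))"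
        "(p, tau, d, q) \<in> set Ds" "b \<in> set As" "s \<in> set (suffixes (enc_list Qs))"
    | (3) b p s where "e = (phase z b p s, Leaf, Fin 0, phase z b p Leaf)"
        "b \<in> set As" "p \<in> set Qs" "s \<in> set (suffixes (enc_list Qs))"
    | (4) b p where "e = (phase z b p (enc_list Qs), Leaf, Omega, phase z b p Leaf)"
        "b \<in> set As" "p \<in> set Qs"
    | (5) p s where "e = (phase z tau p s, end_round, Fin 0, p)"
        "p \<in> set Qs" "s \<in> set (suffixes (enc_list Qs))"
    | (6) b p where "e = (p, b, Fin 0, phase z b p Leaf)" "b \<in> set As" "p \<in> set Qs"
      unfolding duplicator_net_def assms(1-3) by auto
    \<comment> \<open>Families 1 and 5 are emitted inside the loop over actions without depending on
      it; \<open>tau\<close> shows that this loop runs. Likewise \<open>F\<close> supplies a height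
      for families 4 and 6.\<close>
    then show "e \<in> ?l"
      using assms(4) F unfolding dup_edge_list_def assms(2)[symmetric]
      by cases (simp; blast)+
  qed
qed

lemma length_concat_ge: "x \<in> set xs \<Longrightarrow> length (f x) \<le> length (concat (map f xs))"
  by (induction xs) auto

lemma length_concat_ge_mult:
  "(\<And>x. x \<in> set xs \<Longrightarrow> c \<le> length (f x)) \<Longrightarrow> length xs * c \<le> length (concat (map f xs))"
  by (induction xs) (auto intro: add_mono)

text \<open>The edges of a single action suffice: for each of the \<open>length Qs + 1\<close>
  heights there is at least one edge per transition and there are four per state. This is the
  estimate behind the clock.\<close>

lemma length_dup_edge_list:
  assumes "As \<noteq> []"
  shows "(length Qs + 1) * (length Ds + 4 * length Qs) \<le> length (dup_edge_list tau z Qs As Ds)"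
proof -
  obtain b where "b \<in> set As" using assms by (cases As) auto
  have "length (suffixes (enc_list Qs)) * (length Ds * 1 + length Qs * 4) \<le>
      length (concat (map (\<lambda>s.
     concat (map (\<lambda>(p, a, d, q). (phase z a p s, Leaf, Fin d, phase z tau q Leaf) #
       (if a = tau then [(phase z b p (height_before d s), Leaf, Fin d,
          phase z b q (height_after d s))] else [])) Ds) @
     concat (map (\<lambda>p. [(phase z b p s, Leaf, Fin 0, phase z b p Leaf),
       (phase z tau p s, end_round, Fin 0, p),
       (phase z b p (enc_list Qs), Leaf, Omega, phase z b p Leaf),
       (p, b, Fin 0, phase z b p Leaf)]) Qs)) (suffixes (enc_list Qs))))"
    by (rule length_concat_ge_mult, unfold length_append, rule add_mono;
        rule length_concat_ge_mult) auto
  also have "\<dots> \<le> length (dup_edge_list tau z Qs As Ds)"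
    unfolding dup_edge_list_def by (rule length_concat_ge[OF \<open>b \<in> set As\<close>])
  finally show ?thesis by (simp add: algebra_simps)
qed

lemma concat_map_singleton: "concat (map (\<lambda>x. [f x]) xs) = map f xs"
  by (induction xs) auto

lemma spoiler_states_enc:
  assumes "left (left z) = enc_list Qs"
  shows "spoiler_states tau z = enc_list (Qs @ concat (map (\<lambda>q. map (chain z q)
    (suffixes (dup_delta tau z))) Qs))"
proof -
  have *: "spine_concat (\<lambda>v. Node (chain z q (right v)) Leaf) (Node Leaf K) =
      enc_list (map (chain z q) (suffixes K))" for q K
    using spine_concat_suffixes[of "\<lambda>s. Node (chain z q s) Leaf" "\<lambda>s. [chain z q s]"]
    by (simp add: concat_map_singleton)
  show ?thesis
    unfolding spoiler_states_def assms
    by (subst spine_concat_items[OF *]) (rule spine_append_enc_list)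
qed

lemma dup_states_enc:
  assumes "left (right z) = enc_list Qs" "left (right (right z)) = enc_list As"
  shows "dup_states z = enc_list (Qs @ concat (map (\<lambda>b. concat (map (\<lambda>s.
    map (\<lambda>p. phase z b p s) Qs) (suffixes (enc_list Qs)))) As))"
proof -
  have "spine_concat (\<lambda>w. Node (phase z b (left w) s) Leaf) (enc_list Qs) =
      enc_list (map (\<lambda>p. phase z b p s) Qs)" for b s
    using spine_concat_items[of Qs "\<lambda>p. Node (phase z b p s) Leaf" "\<lambda>p. [phase z b p s]"]
    by (simp add: concat_map_singleton)
  from spine_concat_suffixes[OF this] have *:
    "spine_concat (\<lambda>v. spine_concat (\<lambda>w. Node (phase z b (left w) (right v)) Leaf) (enc_list Qs))
      (Node Leaf (enc_list Qs)) =
      enc_list (concat (map (\<lambda>s. map (\<lambda>p. phase z b p s) Qs) (suffixes (enc_list Qs))))" for b .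
  show ?thesis
    unfolding dup_states_def assms
    by (subst spine_concat_items[OF *]) (rule spine_append_enc_list)
qed

definition spoiler_edge_list :: "tree \<Rightarrow> tree \<Rightarrow> tree list \<Rightarrow>
    (tree \<times> tree \<times> int \<times> tree) list \<Rightarrow> (tree \<times> tree \<times> int \<times> tree) list" where
  "spoiler_edge_list z K Qs Ds = map (\<lambda>(p, a, d, q). (p, a, d, chain z q K)) Ds @
     concat (map (\<lambda>q. map (\<lambda>s. if s \<noteq> Leaf then (chain z q s, Leaf, 0, chain z q (right s))
       else (chain z q Leaf, end_round, 0, q)) (suffixes K)) Qs)"

lemma spoiler_delta_enc:
  assumes "left (left z) = enc_list Qs" "right (right (left z)) = enc_list (map (enc_trans enc_int) Ds)"
  shows "spoiler_delta tau z =
    enc_list (map (enc_trans enc_int) (spoiler_edge_list z (dup_delta tau z) Qs Ds))"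
proof -
  let ?K = "dup_delta tau z" and ?e = "enc_trans enc_int"
  let ?step = "\<lambda>q s. if s \<noteq> Leaf then (chain z q s, Leaf, 0, chain z q (right s))
       else (chain z q Leaf, end_round, 0 :: int, q)"
  have "spoiler_step_edge z q s = ?e (?step q s)" for q s
    by (simp add: spoiler_step_edge_def enc_edge_def enc_int_def)
  then have "spine_concat (\<lambda>v. Node (spoiler_step_edge z q (right v)) Leaf) (Node Leaf ?K) =
      enc_list (map (\<lambda>s. ?e (?step q s)) (suffixes ?K))" for q
    using spine_concat_suffixes[of "\<lambda>s. Node (spoiler_step_edge z q s) Leaf" "\<lambda>s. [?e (?step q s)]"]
    by (simp add: concat_map_singleton)
  from spine_concat_items[OF this] have steps:
    "spine_concat (\<lambda>u. spine_concat (\<lambda>v. Node (spoiler_step_edge z (left u) (right v)) Leaf)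
      (Node Leaf ?K)) (enc_list Qs) =
      enc_list (map ?e (concat (map (\<lambda>q. map (?step q) (suffixes ?K)) Qs)))"
    by (simp add: map_concat comp_def)
  have moves: "spine_concat (\<lambda>u. Node (enc_edge (left (left u)) (left (right (left u)))
        (left (right (right (left u)))) (chain z (right (right (right (left u)))) ?K)) Leaf)
        (enc_list (map ?e Ds)) = enc_list (map ?e (map (\<lambda>(p, a, d, q). (p, a, d, chain z q ?K)) Ds))"
    by (induction Ds) (auto simp: enc_edge_def)
  show ?thesis
    unfolding spoiler_delta_def assms steps moves spine_append_enc_list spoiler_edge_list_def
    by simp
qed

lemma set_spoiler_edge_list:
  assumes "set Qs = states N" "set Ds = delta N"
  shows "set (spoiler_edge_list z K Qs Ds) = delta (spoiler_net z K N)"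
  using Leaf_in_suffixes[of K]
  unfolding spoiler_edge_list_def spoiler_net_def assms[symmetric]
  by (auto split: if_splits simp: image_iff) (force | blast)+

lemma weak_elimination_encoded:
  assumes N: "is_ocn N" and N': "is_ocn N'" and tau: "tau \<in> acts N'" and z: "z = Node x y"
    and x: "x = Node (enc_list Qs) (Node (enc_list As) (enc_list (map (enc_trans enc_int) Ds)))"
    and y: "y = Node (enc_list Qs') (Node (enc_list As') (enc_list (map (enc_trans enc_int) Ds')))"
    and sets: "set Qs = states N" "set Qs' = states N'" "set As' = acts N'" "set Ds' = delta N'"
  shows "weak_elimination N N' tau z (enc_list Qs') (dup_delta tau z)"
proof
  show "is_ocn N" "is_ocn N'" "tau \<in> acts N'" by fact+
  show "size q \<le> size z" if "q \<in> states N \<union> states N'" for q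
    using that size_in_enc_list[of q Qs] size_in_enc_list[of q Qs'] unfolding sets[symmetric]
    by (auto simp: z x y)
  show card: "card (states N') \<le> spine (enc_list Qs')"
    using card_length[of Qs'] by (simp add: sets)
  have "\<And>p a d q. (p, a, d, q) \<in> set Ds' \<Longrightarrow> d \<in> {-1, 0, 1}"
    using ocn_states(4)[OF N'] by (simp add: sets)
  then have K: "spine (dup_delta tau z) = length (dup_edge_list tau z Qs' As' Ds')"
    using dup_delta_enc[of z x Qs' As' Ds' tau] by (simp add: z y)
  \<comment> \<open>Here \<open>c\<close> and \<open>q\<close> stand for the products of
    \<open>card (states N')\<close> and of \<open>length Qs'\<close> with \<open>length Qs'\<close>,
    and \<open>k\<close> for \<open>length Ds' * length Qs'\<close>. Then \<open>2 * c\<close> is at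
    most \<open>2 * q\<close>, \<open>2 * d\<close> is at most \<open>e + k\<close>, and the
    constant 5 is covered by \<open>4 * l + 2 * q\<close>.\<close>
  have arith: "2 * (c + d + 2) + 1 \<le> s"
    if "d \<le> e" "l \<le> q" "e \<le> k" "c \<le> q" "e + k + 4 * l + 4 * q \<le> s" "1 \<le> l"
    for c d e k l q s :: nat
    using that by simp
  have "card (delta N') \<le> length Ds'" using card_length[of Ds'] by (simp add: sets)
  moreover assume "states N' \<noteq> {}"
  then have L: "1 \<le> length Qs'" unfolding sets[symmetric] by (cases Qs') auto
  then have "length Qs' * 1 \<le> length Qs' * length Qs'" "length Ds' * 1 \<le> length Ds' * length Qs'"
    by (intro mult_left_mono; simp)+
  moreover have "card (states N') * length Qs' \<le> length Qs' * length Qs'"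
    using card by (intro mult_right_mono) auto
  moreover have "As' \<noteq> []" using tau sets by auto
  from length_dup_edge_list[OF this] have
    "length Ds' + length Ds' * length Qs' + 4 * length Qs' + 4 * (length Qs' * length Qs') \<le>
      spine (dup_delta tau z)"
    unfolding K by (simp add: algebra_simps)
  ultimately show "2 * (card (states N') * spine (enc_list Qs') + card (delta N') + 2) + 1
      \<le> spine (dup_delta tau z)"
    using L arith unfolding spine_enc_list mult_1_right by blast
qed

theorem theorem5p4:
  fixes tau :: tree
  shows "\<exists>f. polytime_on
      {z. \<exists>N N'. is_ocn N \<and> is_ocn N' \<and> tau \<in> acts N \<and> tau \<in> acts N' \<and> encodes_ocns z N N'} f \<and>
    (\<forall>N N' z. is_ocn N \<longrightarrow> is_ocn N' \<longrightarrow> tau \<in> acts N \<longrightarrow> tau \<in> acts N' \<longrightarrow> encodes_ocns z N N' \<longrightarrow>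
      (\<exists>M M'. encodes_ocn_omega (f z) M M' \<and> is_ocn M \<and> is_omega_net M' \<and>
         states N \<subseteq> states M \<and> states N' \<subseteq> states M' \<and>
         (\<forall>q\<in>states N. \<forall>q'\<in>states N'. \<forall>n n'.
            weak_sim (lts_union (ocn_lts N) (ocn_lts N')) tau (Inl (q, n)) (Inr (q', n')) \<longleftrightarrow>
            strong_sim (lts_union (ocn_lts M) (omega_lts M')) (Inl (q, n)) (Inr (q', n')))))"
proof (intro exI[of _ "translate tau"] conjI allI impI polytime_translate)
  fix N N' z
  assume N: "is_ocn N" and N': "is_ocn N'" and tau: "tau \<in> acts N'" and "encodes_ocns z N N'"
  then obtain x y Qs As Ds Qs' As' Ds' where z: "z = Node x y"
    and x: "x = Node (enc_list Qs) (Node (enc_list As) (enc_list (map (enc_trans enc_int) Ds)))"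
    and y: "y = Node (enc_list Qs') (Node (enc_list As') (enc_list (map (enc_trans enc_int) Ds')))"
    and sets: "set Qs = states N" "set As = acts N" "set Ds = delta N"
    and sets': "set Qs' = states N'" "set As' = acts N'" "set Ds' = delta N'"
    unfolding encodes_ocns_def encodes_net_def by blast
  define K where "K = dup_delta tau z"
  let ?M = "spoiler_net z K N" and ?M' = "duplicator_net tau z (enc_list Qs') N'"
  have "encodes_net enc_int (left (translate tau z)) ?M"
    unfolding encodes_net_def
  proof (intro exI conjI)
    show "set (Qs @ concat (map (\<lambda>q. map (chain z q) (suffixes K)) Qs)) = states ?M"
      using sets by (auto simp: spoiler_net_def)
    show "set (Leaf # end_round # As) = acts ?M" using sets by (auto simp: spoiler_net_def)
    show "set (spoiler_edge_list z K Qs Ds) = delta ?M"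
      using sets by (intro set_spoiler_edge_list)
    have "spoiler_states tau z = enc_list (Qs @ concat (map (\<lambda>q. map (chain z q) (suffixes K)) Qs))"
      unfolding K_def by (rule spoiler_states_enc) (simp add: z x)
    moreover have "spoiler_delta tau z = enc_list (map (enc_trans enc_int) (spoiler_edge_list z K Qs Ds))"
      unfolding K_def by (rule spoiler_delta_enc) (simp_all add: z x)
    moreover have "left (right (left z)) = enc_list As" by (simp add: z x)
    ultimately show "left (translate tau z) =
        Node (enc_list (Qs @ concat (map (\<lambda>q. map (chain z q) (suffixes K)) Qs)))
          (Node (enc_list (Leaf # end_round # As))
            (enc_list (map (enc_trans enc_int) (spoiler_edge_list z K Qs Ds))))"
      by (simp add: translate_def)
  qed
  moreover have "encodes_net enc_effect (right (translate tau z)) ?M'"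
    unfolding encodes_net_def
  proof (intro exI conjI)
    let ?Q = "Qs' @ concat (map (\<lambda>b. concat (map (\<lambda>s. map (\<lambda>p. phase z b p s) Qs')
      (suffixes (enc_list Qs')))) As')"
    show "set ?Q = states ?M'"
      unfolding duplicator_net_def sets'[symmetric] by auto
    show "set (Leaf # end_round # As') = acts ?M'"
      using sets' by (auto simp: duplicator_net_def)
    show "set (dup_edge_list tau z Qs' As' Ds') = delta ?M'"
      using sets' tau by (intro set_dup_edge_list)
    have "dup_states z = enc_list ?Q"
      by (rule dup_states_enc) (simp_all add: z y)
    moreover have "dup_delta tau z = enc_list (map (enc_trans enc_effect) (dup_edge_list tau z Qs' As' Ds'))"
      by (rule dup_delta_enc[of z x]) (use z y ocn_states(4)[OF N'] sets' in auto)
    moreover have "left (right (right z)) = enc_list As'" by (simp add: z y)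
    ultimately show "right (translate tau z) = Node (enc_list ?Q)
        (Node (enc_list (Leaf # end_round # As'))
          (enc_list (map (enc_trans enc_effect) (dup_edge_list tau z Qs' As' Ds'))))"
      by (simp add: translate_def)
  qed
  ultimately have "encodes_ocn_omega (translate tau z) ?M ?M'"
    unfolding encodes_ocn_omega_def by (auto simp: translate_def)
  moreover interpret weak_elimination N N' tau z "enc_list Qs'" K
    unfolding K_def by (rule weak_elimination_encoded[OF N N' tau z x y sets(1) sets'])
  have "\<forall>q\<in>states N. \<forall>q'\<in>states N'. \<forall>n n'.
      weak_sim (lts_union (ocn_lts N) (ocn_lts N')) tau (Inl (q, n)) (Inr (q', n')) \<longleftrightarrow>
      strong_sim (lts_union (ocn_lts ?M) (omega_lts ?M')) (Inl (q, n)) (Inr (q', n'))"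
    using weak_sim_iff_strong_sim by blast
  moreover have "states N \<subseteq> states ?M" "states N' \<subseteq> states ?M'"
    by (auto simp: spoiler_net_def duplicator_net_def)
  ultimately show "\<exists>M M'. encodes_ocn_omega (translate tau z) M M' \<and> is_ocn M \<and> is_omega_net M' \<and>
         states N \<subseteq> states M \<and> states N' \<subseteq> states M' \<and>
         (\<forall>q\<in>states N. \<forall>q'\<in>states N'. \<forall>n n'.
            weak_sim (lts_union (ocn_lts N) (ocn_lts N')) tau (Inl (q, n)) (Inr (q', n')) \<longleftrightarrow>
            strong_sim (lts_union (ocn_lts M) (omega_lts M')) (Inl (q, n)) (Inr (q', n')))"
    using is_ocn_spoiler_net[OF N] is_omega_net_duplicator_net[OF N' tau] by blast
qed

end
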